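(* Suppose that $\Delta$ is simply-laced and that the highest root $\theta$ is a fundamental weight. Let $\hat\alpha$ be the unique simple root with $(\theta,\hat\alpha)\ne0$ and let $\hat{\mathfrak a}$ be the maximal abelian ideal of $\mathfrak b$ corresponding to $\hat\alpha$. Then $\mathsf{Ess}(\mathcal F_{\hat{\mathfrak a}})=\mathcal H$, where $\mathcal H=\{\gamma\in\Delta^+\mid(\gamma,\theta)>0\}$.
   Context: Let $\mathfrak g$ be a simple complex Lie algebra with Borel subalgebra $\mathfrak b=\mathfrak t\oplus\mathfrak u^+$, $\Delta$ the root system of $(\mathfrak g,\mathfrak t)$, $\Delta^+$ the positive roots (roots of $\mathfrak u^+$), $\Pi$ the simple roots, $\theta$ the highest root, $W$ the Weyl group, $(\ ,\ )$ a $W$-invariant scalar product, $\sigma_\gamma$ the reflection in $\gamma$. Length in $W$ is with respect to the simple reflections. For $w\in W$, $\mathcal N(w)=\{\gamma\in\Delta^+\mid w(\gamma)\in-\Delta^+\}$. A subset $\mathcal F\subset W$ is a minimal inversion complete set if $\bigcup_{w\in\mathcal F}\mathcal N(w)=\Delta^+$ and the equality fails for any proper subset; $\mathsf{Ess}(\mathcal F)$ is the set of $\gamma\in\Delta^+$ such that there is a unique $w\in\mathcal F$ with $\gamma\in\mathcal N(w)$. Abelian ideals of $\mathfrak b$ are identified with their sets of roots, i.e. with subsets $I\subset\Delta^+$ such that (1) $\gamma\in I$, $\nu\in\Delta^+$, $\gamma+\nu\in\Delta$ imply $\gamma+\nu\in I$; (2) $\gamma+\gamma'\notin\Delta$ for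 $\gamma,\gamma'\in I$. Correspondence between maximal abelian ideals and simple roots (known). Let $\delta$ be the basic imaginary root, $\alpha_0=\delta-\theta$, $\widehat W$ the affine Weyl group generated by $W$ and the reflection $\sigma_0$ in $\alpha_0$, acting on the real affine roots $\Delta+\mathbb Z\delta$ (positive ones: $\nu+k\delta$ with $k>0$, or $k=0$ and $\nu\in\Delta^+$). For each nonzero abelian ideal $I$ there is a unique $w_I\in\widehat W$ whose set of inversions is $\{\delta-\gamma\mid\gamma\in I\}$, and $\tau(I):=w_I(\alpha_0)+\delta$ is a long positive root. Each fibre $\tau^{-1}(\mu)$ has a unique maximal element $I(\mu)_{max}$ with respect to inclusion. For long simple $\alpha$ the ideals $I(\alpha)_{max}$ are exactly the maximal abelian ideals, and $\alpha\mapsto I(\alpha)_{max}$ is a bijection; in the simply-laced case all simple roots are long. The ideal $I(\alpha)_{max}$ is called the maximal abelian ideal corresponding to $\alpha$. For simply-laced $\Delta$ and the maximal abelian ideal $\mathfrak a$ with set of roots $I(\mathfrak a)=I(\alpha)_{max}$, put $\mathcal F_{\mathfrak a}=\{\tilde w_\gamma\mid\gamma\in I(\mathfrak a)\}$, $\tilde w_\gamma=\sigma_\alpha w_{\gamma,\alpha}$, where $w_{\gamma,\alpha}$ is the unique element of minimal length in $W$ taking $\gamma$ to $\alpha$. This is a minimal inversion complete set. *)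

theory Defs
  imports "HOL-Analysis.Analysis"
begin

section \<open>Root systems\<close>

text \<open>The ambient Euclidean space plays the role of the real form of the dual of the Cartan
  subalgebra, its inner product that of the invariant scalar product.\<close>

definition reflection :: "'a::euclidean_space \<Rightarrow> 'a \<Rightarrow> 'a" where
  "reflection \<gamma> x = x - (2 * (x \<bullet> \<gamma>) / (\<gamma> \<bullet> \<gamma>)) *\<^sub>R \<gamma>"

text \<open>Reduced crystallographic root systems.\<close>

definition root_system :: "'a::euclidean_space set \<Rightarrow> bool" where
  "root_system \<Delta> \<longleftrightarrow>
     finite \<Delta> \<and> 0 \<notin> \<Delta> \<and> span \<Delta> = UNIV \<and>
     (\<forall>\<alpha>\<in>\<Delta>. \<forall>c. c *\<^sub>R \<alpha> \<in> \<Delta> \<longleftrightarrow> c = 1 \<or> c = -1) \<and>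
     (\<forall>\<alpha>\<in>\<Delta>. \<forall>\<beta>\<in>\<Delta>. reflection \<alpha> \<beta> \<in> \<Delta>) \<and>
     (\<forall>\<alpha>\<in>\<Delta>. \<forall>\<beta>\<in>\<Delta>. 2 * (\<beta> \<bullet> \<alpha>) / (\<alpha> \<bullet> \<alpha>) \<in> \<int>)"

definition irreducible_root_system :: "'a::euclidean_space set \<Rightarrow> bool" where
  "irreducible_root_system \<Delta> \<longleftrightarrow>
     root_system \<Delta> \<and> \<Delta> \<noteq> {} \<and>
     \<not> (\<exists>X Y. X \<noteq> {} \<and> Y \<noteq> {} \<and> X \<union> Y = \<Delta> \<and> X \<inter> Y = {} \<and>
            (\<forall>\<alpha>\<in>X. \<forall>\<beta>\<in>Y. \<alpha> \<bullet> \<beta> = 0))"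

definition simply_laced :: "'a::euclidean_space set \<Rightarrow> bool" where
  "simply_laced \<Delta> \<longleftrightarrow> (\<forall>\<alpha>\<in>\<Delta>. \<forall>\<beta>\<in>\<Delta>. norm \<alpha> = norm \<beta>)"

definition nonneg_combs :: "'a::euclidean_space set \<Rightarrow> 'a set" where
  "nonneg_combs B = {x. \<exists>c::'a \<Rightarrow> nat. x = (\<Sum>\<alpha>\<in>B. real (c \<alpha>) *\<^sub>R \<alpha>)}"

text \<open>Borel subalgebras containing the Cartan subalgebra correspond to bases of the root
  system.\<close>

definition root_base :: "'a::euclidean_space set \<Rightarrow> 'a set \<Rightarrow> bool" where
  "root_base \<Delta> B \<longleftrightarrow>
     B \<subseteq> \<Delta> \<and> independent B \<and>
     (\<forall>\<gamma>\<in>\<Delta>. \<gamma> \<in> nonneg_combs B \<or> - \<gamma> \<in> nonneg_combs B)"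

definition pos_roots :: "'a::euclidean_space set \<Rightarrow> 'a set \<Rightarrow> 'a set" where
  "pos_roots \<Delta> B = \<Delta> \<inter> nonneg_combs B"

definition highest_root :: "'a::euclidean_space set \<Rightarrow> 'a set \<Rightarrow> 'a" where
  "highest_root \<Delta> B = (THE \<theta>. \<theta> \<in> \<Delta> \<and> (\<forall>\<gamma>\<in>\<Delta>. \<theta> - \<gamma> \<in> nonneg_combs B))"

definition fundamental_weight :: "'a::euclidean_space set \<Rightarrow> 'a \<Rightarrow> bool" where
  "fundamental_weight B \<omega> \<longleftrightarrow>
     (\<exists>\<alpha>\<in>B. \<forall>\<beta>\<in>B. 2 * (\<omega> \<bullet> \<beta>) / (\<beta> \<bullet> \<beta>) = (if \<beta> = \<alpha> then 1 else 0))"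


section \<open>The Weyl group and inversions\<close>

text \<open>The generators are involutions, so no closure under inverses is needed, here and for the
  affine Weyl group below.\<close>

inductive_set weyl_group :: "'a::euclidean_space set \<Rightarrow> ('a \<Rightarrow> 'a) set" for \<Delta> where
  weyl_id: "id \<in> weyl_group \<Delta>"
| weyl_step: "\<gamma> \<in> \<Delta> \<Longrightarrow> w \<in> weyl_group \<Delta> \<Longrightarrow> reflection \<gamma> \<circ> w \<in> weyl_group \<Delta>"

definition weyl_length :: "'a::euclidean_space set \<Rightarrow> ('a \<Rightarrow> 'a) \<Rightarrow> nat" where
  "weyl_length B w =
     (LEAST n. \<exists>as. set as \<subseteq> B \<and> length as = n \<and> w = foldr (\<lambda>\<alpha> v. reflection \<alpha> \<circ> v) as id)"

definition inversions :: "'a::euclidean_space set \<Rightarrow> 'a set \<Rightarrow> ('a \<Rightarrow> 'a) \<Rightarrow> 'a set" where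
  "inversions \<Delta> B w = {\<gamma> \<in> pos_roots \<Delta> B. - w \<gamma> \<in> pos_roots \<Delta> B}"

definition Ess :: "'a::euclidean_space set \<Rightarrow> 'a set \<Rightarrow> ('a \<Rightarrow> 'a) set \<Rightarrow> 'a set" where
  "Ess \<Delta> B F = {\<gamma> \<in> pos_roots \<Delta> B. \<exists>!w. w \<in> F \<and> \<gamma> \<in> inversions \<Delta> B w}"


section \<open>The affine Weyl group\<close>

text \<open>A pair (x, c) stands for x + c \<delta>; in particular a real affine root is a pair (\<nu>, k) with
  \<nu> a root and k an integer. Since \<delta> is isotropic and orthogonal to everything, the affine
  reflections are not the orthogonal reflections of the product space.\<close>

definition affine_reflection ::
    "'a::euclidean_space \<times> real \<Rightarrow> 'a \<times> real \<Rightarrow> 'a \<times> real" where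
  "affine_reflection \<beta> x = x - (2 * (fst x \<bullet> fst \<beta>) / (fst \<beta> \<bullet> fst \<beta>)) *\<^sub>R \<beta>"

definition basic_imaginary_root :: "'a::euclidean_space \<times> real" where
  "basic_imaginary_root = (0, 1)"

definition alpha0 :: "'a::euclidean_space set \<Rightarrow> 'a set \<Rightarrow> 'a \<times> real" where
  "alpha0 \<Delta> B = basic_imaginary_root - (highest_root \<Delta> B, 0)"

definition pos_affine_roots :: "'a::euclidean_space set \<Rightarrow> 'a set \<Rightarrow> ('a \<times> real) set" where
  "pos_affine_roots \<Delta> B =
     {(\<nu>, of_int k) | \<nu> k. \<nu> \<in> \<Delta> \<and> (k > 0 \<or> k = 0 \<and> \<nu> \<in> pos_roots \<Delta> B)}"

inductive_set affine_weyl_group ::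
    "'a::euclidean_space set \<Rightarrow> 'a set \<Rightarrow> ('a \<times> real \<Rightarrow> 'a \<times> real) set" for \<Delta> B where
  affine_id: "id \<in> affine_weyl_group \<Delta> B"
| affine_finite_step: "\<gamma> \<in> \<Delta> \<Longrightarrow> w \<in> affine_weyl_group \<Delta> B \<Longrightarrow>
     affine_reflection (\<gamma>, 0) \<circ> w \<in> affine_weyl_group \<Delta> B"
| affine_zero_step: "w \<in> affine_weyl_group \<Delta> B \<Longrightarrow>
     affine_reflection (alpha0 \<Delta> B) \<circ> w \<in> affine_weyl_group \<Delta> B"

definition affine_inversions ::
    "'a::euclidean_space set \<Rightarrow> 'a set \<Rightarrow> ('a \<times> real \<Rightarrow> 'a \<times> real) \<Rightarrow> ('a \<times> real) set" where
  "affine_inversions \<Delta> B w =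
     {\<beta> \<in> pos_affine_roots \<Delta> B. - w \<beta> \<in> pos_affine_roots \<Delta> B}"


section \<open>Abelian ideals\<close>

definition abelian_ideal :: "'a::euclidean_space set \<Rightarrow> 'a set \<Rightarrow> 'a set \<Rightarrow> bool" where
  "abelian_ideal \<Delta> B I \<longleftrightarrow>
     I \<subseteq> pos_roots \<Delta> B \<and>
     (\<forall>\<gamma>\<in>I. \<forall>\<nu>\<in>pos_roots \<Delta> B. \<gamma> + \<nu> \<in> \<Delta> \<longrightarrow> \<gamma> + \<nu> \<in> I) \<and>
     (\<forall>\<gamma>\<in>I. \<forall>\<gamma>'\<in>I. \<gamma> + \<gamma>' \<notin> \<Delta>)"

definition ideal_element ::
    "'a::euclidean_space set \<Rightarrow> 'a set \<Rightarrow> 'a set \<Rightarrow> 'a \<times> real \<Rightarrow> 'a \<times> real" where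
  "ideal_element \<Delta> B I =
     (THE w. w \<in> affine_weyl_group \<Delta> B \<and>
             affine_inversions \<Delta> B w = {basic_imaginary_root - (\<gamma>, 0) | \<gamma>. \<gamma> \<in> I})"

definition tau :: "'a::euclidean_space set \<Rightarrow> 'a set \<Rightarrow> 'a set \<Rightarrow> 'a \<times> real" where
  "tau \<Delta> B I = ideal_element \<Delta> B I (alpha0 \<Delta> B) + basic_imaginary_root"

definition tau_fibre :: "'a::euclidean_space set \<Rightarrow> 'a set \<Rightarrow> 'a \<Rightarrow> 'a set set" where
  "tau_fibre \<Delta> B \<mu> = {I. abelian_ideal \<Delta> B I \<and> I \<noteq> {} \<and> tau \<Delta> B I = (\<mu>, 0)}"

text \<open>The unique element of the fibre that is maximal with respect to inclusion; for a long
  simple root it is the maximal abelian ideal corresponding to that root.\<close>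

definition max_ideal :: "'a::euclidean_space set \<Rightarrow> 'a set \<Rightarrow> 'a \<Rightarrow> 'a set" where
  "max_ideal \<Delta> B \<mu> =
     (THE I. I \<in> tau_fibre \<Delta> B \<mu> \<and> (\<forall>J\<in>tau_fibre \<Delta> B \<mu>. I \<subseteq> J \<longrightarrow> J = I))"

definition min_element :: "'a::euclidean_space set \<Rightarrow> 'a set \<Rightarrow> 'a \<Rightarrow> 'a \<Rightarrow> 'a \<Rightarrow> 'a" where
  "min_element \<Delta> B \<gamma> \<alpha> =
     (THE w. w \<in> weyl_group \<Delta> \<and> w \<gamma> = \<alpha> \<and>
             (\<forall>v\<in>weyl_group \<Delta>. v \<gamma> = \<alpha> \<longrightarrow> weyl_length B w \<le> weyl_length B v))"

text \<open>The inversion complete set attached to the maximal abelian ideal corresponding to the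
  simple root \<alpha> (for a simply-laced root system).\<close>

definition ideal_inversion_set ::
    "'a::euclidean_space set \<Rightarrow> 'a set \<Rightarrow> 'a \<Rightarrow> ('a \<Rightarrow> 'a) set" where
  "ideal_inversion_set \<Delta> B \<alpha> =
     {reflection \<alpha> \<circ> min_element \<Delta> B \<gamma> \<alpha> | \<gamma>. \<gamma> \<in> max_ideal \<Delta> B \<alpha>}"

end

theory Submission
  imports Defs
begin

text \<open>
  Pairings are normalised so that every root pairs to 2 with itself. Since \<theta> is the fundamental
  weight of \<alpha>, the pairing of a root with \<theta> is its coefficient at \<alpha>. This grades the
  roots in degrees -2 to 2, with \<theta> the only root of degree 2, and \<H> consists of \<theta> and the
  roots of degree one; the latter come in pairs with sum \<theta>. The proof has three parts.

  The ideal. The maximal abelian ideal of \<alpha> is the set \<I> formed by \<theta> and the roots \<gamma> of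
  degree one with (\<gamma>, \<alpha>) \<le> 0: it contains \<theta> and one root from each pair. In fact it is
  the only member of its fibre (\<open>heisenberg_ideal_fibre\<close>, \<open>tau_fibre_unique\<close>). An element of the
  affine Weyl group sends x + c\<delta> to g x + (c + (x, s))\<delta> with g in the finite Weyl group and s in the
  root lattice. For a member of the fibre s is dominant, (\<theta>, s) = 2 and g \<theta> = - \<alpha>. The root
  of degree one that g sends to - \<theta> must be \<alpha> itself, because otherwise a nonzero minuscule element
  of the root lattice would appear, and there is none (\<open>minuscule_root_lattice\<close>). Now s pairs with
  roots as \<theta> does and g exchanges \<theta> and \<alpha> up to sign, which decides the sign of g on every
  root of degree one.

  The inversions. A shortest element w taking \<gamma> to \<alpha> is the unique one that keeps positive
  the positive roots orthogonal to \<gamma> (\<open>min_element\<close>, \<open>reduced_unique\<close>). If \<gamma> has degree one,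
  then w fixes \<theta>, hence preserves degrees, and the element attached to \<gamma> inverts exactly \<gamma> and the
  positive roots \<nu> of degree zero with (\<nu>, \<gamma>) = 1 (\<open>inversions_covering_degree_one\<close>). The
  element attached to \<theta> inverts \<theta> and the roots of degree one outside \<I>
  (\<open>inversions_covering_theta\<close>). So each root of \<H> is covered exactly once.

  The roots of degree zero. It remains to see that the number of \<gamma> in \<I> with (\<nu>, \<gamma>) = 1 is never
  one (\<open>second_cover\<close>). Behind this are triples of mutually orthogonal roots of degree zero, each
  pairing to -1 with \<alpha>, whose sum is \<theta> - 2\<alpha>: they allow the construction of a second \<gamma> from
  a given one.
\<close>

section \<open>Pairings of roots\<close>

text \<open>The common squared length N of the roots is a parameter, so that the normalised pairing is an
  honest bilinear form on the ambient space.\<close>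

locale laced_root_system =
  fixes \<Delta> B :: "'a::euclidean_space set" and N :: real
  assumes irreducible: "irreducible_root_system \<Delta>"
    and base: "root_base \<Delta> B"
    and sq_norm: "\<gamma> \<in> \<Delta> \<Longrightarrow> \<gamma> \<bullet> \<gamma> = N"
    and N_pos: "N > 0"
begin

definition pairing :: "'a \<Rightarrow> 'a \<Rightarrow> real" (infix "\<cdot>" 70) where
  "x \<cdot> y = 2 * (x \<bullet> y) / N"

abbreviation nn where "nn \<equiv> nonneg_combs B"
abbreviation P where "P \<equiv> pos_roots \<Delta> B"
abbreviation W where "W \<equiv> weyl_group \<Delta>"

lemma pairing_commute: "x \<cdot> y = y \<cdot> x"
  by (simp add: pairing_def inner_commute)

lemma pairing_simps [simp]:
  "(x + y) \<cdot> z = x \<cdot> z + y \<cdot> z" "z \<cdot> (x + y) = z \<cdot> x + z \<cdot> y"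
  "(x - y) \<cdot> z = x \<cdot> z - y \<cdot> z" "z \<cdot> (x - y) = z \<cdot> x - z \<cdot> y"
  "(- x) \<cdot> z = - (x \<cdot> z)" "z \<cdot> (- x) = - (z \<cdot> x)"
  "0 \<cdot> z = 0" "z \<cdot> 0 = 0"
  "(c *\<^sub>R x) \<cdot> z = c * (x \<cdot> z)" "z \<cdot> (c *\<^sub>R x) = c * (z \<cdot> x)"
  by (simp_all add: pairing_def inner_diff_left inner_diff_right inner_add_left inner_add_right
      diff_divide_distrib add_divide_distrib distrib_left right_diff_distrib)

lemma pairing_sum: "z \<cdot> (\<Sum>i\<in>A. f i) = (\<Sum>i\<in>A. z \<cdot> f i)"
  by (simp add: pairing_def inner_sum_right sum_divide_distrib sum_distrib_left)

lemma pairing_eq_0_imp: "x \<cdot> x = 0 \<Longrightarrow> x = 0"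
  using N_pos by (simp add: pairing_def)

lemma pairing_nonneg: "x \<cdot> x \<ge> 0"
  using N_pos by (simp add: pairing_def)

lemma root_system: "root_system \<Delta>"
  using irreducible by (simp add: irreducible_root_system_def)

lemma finite_roots: "finite \<Delta>" and root_nonzero: "0 \<notin> \<Delta>"
  using root_system by (auto simp: root_system_def)

lemma uminus_root: "\<gamma> \<in> \<Delta> \<Longrightarrow> - \<gamma> \<in> \<Delta>"
proof -
  assume g: "\<gamma> \<in> \<Delta>"
  have "(-1) *\<^sub>R \<gamma> \<in> \<Delta>" using root_system g unfolding root_system_def by blast
  then show ?thesis by simp
qed

lemma uminus_root_iff [simp]: "- \<gamma> \<in> \<Delta> \<longleftrightarrow> \<gamma> \<in> \<Delta>"
  using uminus_root[of \<gamma>] uminus_root[of "- \<gamma>"] by auto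

lemma pairing_self: "\<gamma> \<in> \<Delta> \<Longrightarrow> \<gamma> \<cdot> \<gamma> = 2"
  using N_pos by (simp add: pairing_def sq_norm)

lemma reflection_pairing: "\<gamma> \<in> \<Delta> \<Longrightarrow> reflection \<gamma> x = x - (x \<cdot> \<gamma>) *\<^sub>R \<gamma>"
  by (simp add: reflection_def pairing_def sq_norm)

lemma reflection_root: "\<gamma> \<in> \<Delta> \<Longrightarrow> \<mu> \<in> \<Delta> \<Longrightarrow> reflection \<gamma> \<mu> \<in> \<Delta>"
  using root_system by (simp add: root_system_def)

lemma pairing_Ints: assumes "\<gamma> \<in> \<Delta>" "\<mu> \<in> \<Delta>" shows "\<gamma> \<cdot> \<mu> \<in> \<int>"
proof -
  have "2 * (\<gamma> \<bullet> \<mu>) / (\<mu> \<bullet> \<mu>) \<in> \<int>" using root_system assms unfolding root_system_def by blast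
  then show ?thesis using assms by (simp add: pairing_def sq_norm)
qed

text \<open>Equal root lengths leave only the pairings -1, 0 and 1 for distinct non-opposite roots.
  So whether a sum or a difference of two roots is a root can be read off from their
  pairing.\<close>

lemma pairing_cases:
  assumes "\<gamma> \<in> \<Delta>" "\<mu> \<in> \<Delta>"
  shows "\<gamma> = \<mu> \<and> \<gamma> \<cdot> \<mu> = 2 \<or> \<gamma> = - \<mu> \<and> \<gamma> \<cdot> \<mu> = -2 \<or> \<gamma> \<noteq> \<mu> \<and> \<gamma> \<noteq> - \<mu> \<and> \<gamma> \<cdot> \<mu> \<in> {-1, 0, 1}"
proof -
  have d: "(\<gamma> - \<mu>) \<cdot> (\<gamma> - \<mu>) = 4 - 2 * (\<gamma> \<cdot> \<mu>)" "(\<gamma> + \<mu>) \<cdot> (\<gamma> + \<mu>) = 4 + 2 * (\<gamma> \<cdot> \<mu>)"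
    using assms by (simp_all add: pairing_self pairing_commute[of \<mu> \<gamma>])
  obtain k :: int where k: "\<gamma> \<cdot> \<mu> = of_int k" using pairing_Ints[OF assms] by (auto elim: Ints_cases)
  have "k \<le> 2" "k \<ge> -2"
    using pairing_nonneg[of "\<gamma> - \<mu>"] pairing_nonneg[of "\<gamma> + \<mu>"] unfolding d k by linarith+
  then have "k = -2 \<or> k \<in> {-1, 0, 1} \<or> k = 2" by auto
  moreover have "k = 2 \<longleftrightarrow> \<gamma> = \<mu>"
    using pairing_eq_0_imp[of "\<gamma> - \<mu>"] assms k unfolding d by (auto simp: pairing_self)
  moreover have "k = -2 \<longleftrightarrow> \<gamma> = - \<mu>"
    using pairing_eq_0_imp[of "\<gamma> + \<mu>"] assms k unfolding d
    by (auto simp: pairing_self add_eq_0_iff2)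
  ultimately show ?thesis using k by auto
qed

lemma pairing_minus_2D: "\<gamma> \<in> \<Delta> \<Longrightarrow> \<mu> \<in> \<Delta> \<Longrightarrow> \<gamma> \<cdot> \<mu> = -2 \<Longrightarrow> \<gamma> = - \<mu>"
  using pairing_cases[of \<gamma> \<mu>] by auto

lemma root_diff: "\<gamma> \<in> \<Delta> \<Longrightarrow> \<mu> \<in> \<Delta> \<Longrightarrow> \<gamma> \<cdot> \<mu> = 1 \<Longrightarrow> \<gamma> - \<mu> \<in> \<Delta>"
  using reflection_root[of \<mu> \<gamma>] by (simp add: reflection_pairing)

lemma root_add: "\<gamma> \<in> \<Delta> \<Longrightarrow> \<mu> \<in> \<Delta> \<Longrightarrow> \<gamma> \<cdot> \<mu> = -1 \<Longrightarrow> \<gamma> + \<mu> \<in> \<Delta>"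
  using reflection_root[of \<mu> \<gamma>] by (simp add: reflection_pairing)

lemma reflection_self: "\<gamma> \<in> \<Delta> \<Longrightarrow> reflection \<gamma> \<gamma> = - \<gamma>"
  by (simp add: reflection_pairing pairing_self scaleR_2)

lemma reflection_invol: "\<gamma> \<in> \<Delta> \<Longrightarrow> reflection \<gamma> (reflection \<gamma> x) = x"
  by (simp add: reflection_pairing pairing_self algebra_simps)

lemma reflection_comp_invol: "\<gamma> \<in> \<Delta> \<Longrightarrow> reflection \<gamma> \<circ> reflection \<gamma> = id"
  by (rule ext) (simp add: reflection_invol)

lemma reflection_isometry: "\<gamma> \<in> \<Delta> \<Longrightarrow> reflection \<gamma> x \<cdot> reflection \<gamma> y = x \<cdot> y"
  by (simp add: reflection_pairing pairing_self pairing_commute[of \<gamma> x] pairing_commute[of \<gamma> y] algebra_simps)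

lemma linear_reflection: "linear (reflection \<gamma>)"
  by (rule linearI) (simp_all add: reflection_def inner_simps algebra_simps add_divide_distrib)

section \<open>Positivity\<close>

lemma base_root: "b \<in> B \<Longrightarrow> b \<in> \<Delta>" and independent_base: "independent B"
  and root_sign: "\<gamma> \<in> \<Delta> \<Longrightarrow> \<gamma> \<in> nn \<or> - \<gamma> \<in> nn"
  using base by (auto simp: root_base_def)

lemma finite_base: "finite B"
  by (rule finite_subset[OF _ finite_roots]) (use base_root in blast)

lemma nn_zero: "0 \<in> nn"
proof -
  have "0 = (\<Sum>b\<in>B. real 0 *\<^sub>R b)" by simp
  then show ?thesis unfolding nonneg_combs_def by (intro CollectI exI)
qed

lemma nn_base: assumes "b \<in> B" shows "b \<in> nn"
proof -
  have "b = (\<Sum>x\<in>B. real (if x = b then 1 else 0) *\<^sub>R x)"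
  proof -
    have "(\<Sum>x\<in>B. real (if x = b then 1 else 0) *\<^sub>R x) = (\<Sum>x\<in>B. if x = b then x else 0)"
      by (rule sum.cong) auto
    then show ?thesis using assms by (simp add: finite_base)
  qed
  then show ?thesis unfolding nonneg_combs_def by (intro CollectI exI)
qed

lemma nn_add: assumes "x \<in> nn" "y \<in> nn" shows "x + y \<in> nn"
proof -
  from assms obtain c d :: "'a \<Rightarrow> nat" where
    "x = (\<Sum>b\<in>B. real (c b) *\<^sub>R b)" "y = (\<Sum>b\<in>B. real (d b) *\<^sub>R b)"
    unfolding nonneg_combs_def by auto
  then have "x + y = (\<Sum>b\<in>B. real (c b + d b) *\<^sub>R b)"
    by (simp add: scaleR_left_distrib sum.distrib)
  then show ?thesis unfolding nonneg_combs_def by (intro CollectI exI)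
qed

lemma nn_pairing_nonneg:
  assumes "x \<in> nn" "\<And>b. b \<in> B \<Longrightarrow> y \<cdot> b \<ge> 0" shows "y \<cdot> x \<ge> 0"
proof -
  from assms(1) obtain c :: "'a \<Rightarrow> nat" where x: "x = (\<Sum>b\<in>B. real (c b) *\<^sub>R b)"
    unfolding nonneg_combs_def by auto
  show ?thesis unfolding x pairing_sum by (rule sum_nonneg) (simp add: assms(2))
qed

lemma nn_pairing_pos:
  assumes "x \<in> nn" "y \<cdot> x > 0" shows "\<exists>b\<in>B. y \<cdot> b > 0"
proof (rule ccontr)
  assume "\<not> ?thesis"
  then have "(- y) \<cdot> x \<ge> 0" by (intro nn_pairing_nonneg[OF assms(1)]) (auto simp: not_less)
  then show False using assms(2) by simp
qed

text \<open>The linear functional with value 1 on the base; inductions over positive roots run along it.\<close>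

definition height :: "'a \<Rightarrow> real" where
  "height = (SOME f. linear f \<and> (\<forall>b\<in>B. f b = 1))"

lemma linear_height: "linear height" and height_base: "b \<in> B \<Longrightarrow> height b = 1"
proof -
  have "\<exists>f::'a \<Rightarrow> real. linear f \<and> (\<forall>b\<in>B. f b = 1)"
    using linear_independent_extend[OF independent_base, of "\<lambda>_. 1"] by auto
  then have "linear height \<and> (\<forall>b\<in>B. height b = 1)"
    unfolding height_def by (rule someI_ex)
  then show "linear height" "b \<in> B \<Longrightarrow> height b = 1" by auto
qed

lemmas height_simps [simp] = linear_add[OF linear_height] linear_diff[OF linear_height]
  linear_neg[OF linear_height] linear_0[OF linear_height] linear_cmul[OF linear_height]

lemma nn_height: assumes "x \<in> nn" shows "height x \<ge> 0" "x \<noteq> 0 \<Longrightarrow> height x \<ge> 1"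
proof -
  from assms obtain c :: "'a \<Rightarrow> nat" where x: "x = (\<Sum>b\<in>B. real (c b) *\<^sub>R b)"
    unfolding nonneg_combs_def by auto
  have "height x = (\<Sum>b\<in>B. real (c b))"
    unfolding x by (simp add: linear_sum[OF linear_height] height_base)
  then have h: "height x = real (\<Sum>b\<in>B. c b)" by simp
  show "height x \<ge> 0" unfolding h by (rule of_nat_0_le_iff)
  assume "x \<noteq> 0"
  have "(\<Sum>b\<in>B. c b) \<noteq> 0"
  proof
    assume "(\<Sum>b\<in>B. c b) = 0"
    then have "\<forall>b\<in>B. c b = 0" using finite_base by simp
    then have "x = 0" unfolding x by (intro sum.neutral) simp
    then show False using \<open>x \<noteq> 0\<close> by simp
  qed
  then show "height x \<ge> 1" unfolding h by linarith
qed

lemma nn_antisym: "x \<in> nn \<Longrightarrow> - x \<in> nn \<Longrightarrow> x = 0"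
  using nn_height(2)[of x] nn_height(1)[of "- x"] by (cases "x = 0") auto

lemma pos_root: "p \<in> P \<Longrightarrow> p \<in> \<Delta>" and pos_nn: "p \<in> P \<Longrightarrow> p \<in> nn"
  and posI: "p \<in> \<Delta> \<Longrightarrow> p \<in> nn \<Longrightarrow> p \<in> P"
  by (auto simp: pos_roots_def)

lemma base_pos: "b \<in> B \<Longrightarrow> b \<in> P"
  by (simp add: posI base_root nn_base)

lemma pos_height: "p \<in> P \<Longrightarrow> height p \<ge> 1"
  using nn_height(2)[OF pos_nn, of p] root_nonzero pos_root[of p] by metis

lemma neg_pos_iff: "\<gamma> \<in> \<Delta> \<Longrightarrow> - \<gamma> \<in> P \<longleftrightarrow> \<gamma> \<notin> P"
proof -
  assume g: "\<gamma> \<in> \<Delta>"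
  have "\<not> (- \<gamma> \<in> P \<and> \<gamma> \<in> P)" using pos_height[of \<gamma>] pos_height[of "- \<gamma>"] by fastforce
  moreover have "- \<gamma> \<in> P \<or> \<gamma> \<in> P"
    using root_sign[OF g] posI[OF g] posI[of "- \<gamma>"] uminus_root[OF g] by blast
  ultimately show ?thesis by blast
qed

text \<open>If the difference were negative, the simple root would be a sum of two positive roots,
  whose height is at least 2.\<close>

lemma simple_diff_pos:
  assumes "p \<in> P" "b \<in> B" "p \<cdot> b = 1" shows "p - b \<in> P"
proof (rule ccontr)
  have r: "p - b \<in> \<Delta>" using assms by (simp add: root_diff pos_root base_root)
  assume "p - b \<notin> P"
  then have "- (p - b) \<in> P" using r neg_pos_iff by blast
  from pos_height[OF this] pos_height[OF assms(1)] height_base[OF assms(2)] show False by simp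
qed

lemma simple_reflection_pos:
  assumes "p \<in> P" "b \<in> B" "p \<noteq> b" shows "reflection b p \<in> P"
proof -
  note r = pos_root[OF assms(1)] base_root[OF assms(2)]
  have "p \<noteq> - b" using assms base_pos neg_pos_iff r by auto
  then consider "p \<cdot> b = -1" | "p \<cdot> b = 0" | "p \<cdot> b = 1"
    using pairing_cases[OF r] assms(3) by auto
  then show ?thesis
  proof cases
    case 1 then show ?thesis using assms r root_add[OF r]
      by (auto simp: reflection_pairing intro!: posI nn_add dest: pos_nn nn_base)
  qed (use assms r simple_diff_pos in \<open>auto simp: reflection_pairing\<close>)
qed

lemma nonsimple_descent:
  assumes "p \<in> P" "p \<notin> B" shows "\<exists>b\<in>B. p \<cdot> b = 1"
proof -
  have "p \<cdot> p > 0" using pairing_self[OF pos_root[OF assms(1)]] by simp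
  from nn_pairing_pos[OF pos_nn[OF assms(1)] this] obtain b where b: "b \<in> B" "p \<cdot> b > 0" by auto
  then show ?thesis using pairing_cases[OF pos_root[OF assms(1)] base_root[OF b(1)]] assms(2) by force
qed

text \<open>Heights of nonnegative combinations are natural numbers, although the height is
  real-valued.\<close>

lemma height_induct [consumes 1, case_names less]:
  assumes "x \<in> nn"
    and "\<And>x. x \<in> nn \<Longrightarrow> (\<And>y. y \<in> nn \<Longrightarrow> height y + 1 \<le> height x \<Longrightarrow> Q y) \<Longrightarrow> Q x"
  shows "Q x"
  using assms(1)
proof (induction "nat \<lfloor>height x\<rfloor>" arbitrary: x rule: less_induct)
  case less
  show ?case
  proof (rule assms(2)[OF less(2)])
    fix y assume y: "y \<in> nn" "height y + 1 \<le> height x"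
    then have "nat \<lfloor>height y\<rfloor> < nat \<lfloor>height x\<rfloor>" using nn_height(1)[OF y(1)] by linarith
    then show "Q y" using less(1) y(1) by blast
  qed
qed

section \<open>The Weyl group\<close>

lemma weyl_reflection: "\<gamma> \<in> \<Delta> \<Longrightarrow> reflection \<gamma> \<in> W"
  using weyl_step[OF _ weyl_id, of \<gamma> \<Delta>] by simp

lemma weyl_comp: "w \<in> W \<Longrightarrow> v \<in> W \<Longrightarrow> w \<circ> v \<in> W"
  by (induction rule: weyl_group.induct) (auto simp: comp_assoc intro: weyl_step)

lemma weyl_linear: "w \<in> W \<Longrightarrow> linear w"
proof (induction rule: weyl_group.induct)
  case weyl_id
  show ?case by (rule linear_id)
next
  case (weyl_step \<gamma> w)
  then show ?case by (blast intro: linear_compose linear_reflection)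
qed

lemma weyl_simps:
  assumes "w \<in> W"
  shows "w (x + y) = w x + w y" "w (x - y) = w x - w y" "w (- x) = - w x" "w 0 = 0"
    "w (c *\<^sub>R x) = c *\<^sub>R w x"
  using weyl_linear[OF assms]
  by (simp_all add: linear_add linear_diff linear_neg linear_0 linear_cmul)

lemma weyl_isometry: "w \<in> W \<Longrightarrow> w x \<cdot> w y = x \<cdot> y"
  by (induction arbitrary: x y rule: weyl_group.induct) (auto simp: reflection_isometry)

lemma weyl_root: "w \<in> W \<Longrightarrow> \<gamma> \<in> \<Delta> \<Longrightarrow> w \<gamma> \<in> \<Delta>"
  by (induction rule: weyl_group.induct) (auto simp: reflection_root)

lemma weyl_inverse: "w \<in> W \<Longrightarrow> \<exists>v\<in>W. v \<circ> w = id \<and> w \<circ> v = id"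
proof (induction rule: weyl_group.induct)
  case weyl_id
  show ?case by (rule bexI[of _ id]) (auto intro: weyl_group.weyl_id)
next
  case (weyl_step \<gamma> w)
  then obtain v where v: "v \<in> W" "v \<circ> w = id" "w \<circ> v = id" by blast
  have "(v \<circ> reflection \<gamma>) \<circ> (reflection \<gamma> \<circ> w) = id"
    using v(2) by (auto simp: fun_eq_iff reflection_invol weyl_step.hyps)
  moreover have "(reflection \<gamma> \<circ> w) \<circ> (v \<circ> reflection \<gamma>) = id"
    using v(3) by (auto simp: fun_eq_iff reflection_invol weyl_step.hyps)
  moreover have "v \<circ> reflection \<gamma> \<in> W"
    using v(1) weyl_step.hyps by (simp add: weyl_comp weyl_reflection)
  ultimately show ?case by blast
qed

lemma weyl_inverseE:
  assumes "w \<in> W"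
  obtains v where "v \<in> W" "\<And>x. v (w x) = x" "\<And>x. w (v x) = x"
  using weyl_inverse[OF assms] by (auto simp: fun_eq_iff)

lemma weyl_reflection_conj:
  assumes "w \<in> W" "\<gamma> \<in> \<Delta>" shows "reflection (w \<gamma>) \<circ> w = w \<circ> reflection \<gamma>"
  using assms by (auto simp: fun_eq_iff reflection_pairing weyl_root weyl_isometry weyl_simps)

lemma weyl_neg_pos_iff: "w \<in> W \<Longrightarrow> \<gamma> \<in> \<Delta> \<Longrightarrow> - w \<gamma> \<in> P \<longleftrightarrow> w \<gamma> \<notin> P"
  by (simp add: neg_pos_iff weyl_root)

text \<open>Products of simple reflections, in exactly the form in which the length function counts
  them.\<close>

definition word :: "'a list \<Rightarrow> 'a \<Rightarrow> 'a" where
  "word as = foldr (\<lambda>\<alpha> v. reflection \<alpha> \<circ> v) as id"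

lemma word_Nil [simp]: "word [] = id" and word_Cons [simp]: "word (a # as) = reflection a \<circ> word as"
  by (simp_all add: word_def)

lemma word_append: "word (as @ bs) = word as \<circ> word bs"
  by (induction as) (simp_all only: append.simps word_Nil word_Cons comp_assoc id_comp)

lemma word_weyl: "set as \<subseteq> B \<Longrightarrow> word as \<in> W"
  by (induction as) (simp_all only: word_Nil word_Cons weyl_id weyl_step base_root list.simps insert_subset)

lemma reflection_uminus: "reflection (- \<gamma>) = reflection \<gamma>"
  by (rule ext) (simp add: reflection_def)

text \<open>A positive root that is not simple is carried by a simple reflection to a positive root
  of smaller height, and the two reflections are conjugate.\<close>

lemma pos_reflection_word: "p \<in> P \<Longrightarrow> \<exists>as. set as \<subseteq> B \<and> reflection p = word as"
proof -
  assume "p \<in> P"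
  have "p \<in> nn \<Longrightarrow> p \<in> P \<longrightarrow> (\<exists>as. set as \<subseteq> B \<and> reflection p = word as)"
  proof (induction rule: height_induct)
    case (less p)
    show ?case
    proof
      assume p: "p \<in> P"
      show "\<exists>as. set as \<subseteq> B \<and> reflection p = word as"
      proof (cases "p \<in> B")
        case True
        then show ?thesis by (intro exI[of _ "[p]"]) simp
      next
        case False
        then obtain b where b: "b \<in> B" "p \<cdot> b = 1" using nonsimple_descent p by blast
        have q: "p - b \<in> P" using simple_diff_pos p b by blast
        have "height (p - b) + 1 \<le> height p" using b by (simp add: height_base)
        from less(2)[OF pos_nn[OF q] this] q obtain as
          where as: "set as \<subseteq> B" "reflection (p - b) = word as" by blast
        have "p - b = reflection b p" using b by (simp add: reflection_pairing base_root)
        then have "reflection (p - b) \<circ> reflection b = reflection b \<circ> reflection p"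
          using weyl_reflection_conj[OF weyl_reflection pos_root[OF p]] base_root[OF b(1)] by simp
        then have "reflection p = reflection b \<circ> reflection (p - b) \<circ> reflection b"
          using reflection_comp_invol[OF base_root[OF b(1)]] by (metis comp_assoc id_comp)
        also have "\<dots> = word (b # as @ [b])" using as(2) by (simp add: word_append comp_assoc)
        finally show ?thesis using as(1) b(1) by (intro exI[of _ "b # as @ [b]"]) auto
      qed
    qed
  qed
  then show ?thesis using \<open>p \<in> P\<close> pos_nn by blast
qed

lemma weyl_word: "w \<in> W \<Longrightarrow> \<exists>as. set as \<subseteq> B \<and> w = word as"
proof (induction rule: weyl_group.induct)
  case weyl_id
  show ?case by (intro exI[of _ "[]"]) simp
next
  case (weyl_step \<gamma> w)
  then obtain as where as: "set as \<subseteq> B" "w = word as" by blast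
  have "\<gamma> \<in> P \<or> - \<gamma> \<in> P" using neg_pos_iff weyl_step.hyps by blast
  then obtain bs where bs: "set bs \<subseteq> B" "reflection \<gamma> = word bs"
    using pos_reflection_word[of \<gamma>] pos_reflection_word[of "- \<gamma>"] by (auto simp: reflection_uminus)
  then show ?case using as by (intro exI[of _ "bs @ as"]) (auto simp: word_append)
qed

lemma weyl_shortest_word:
  assumes "w \<in> W"
  obtains as where "set as \<subseteq> B" "length as = weyl_length B w" "w = word as"
proof -
  have "\<exists>n as. set as \<subseteq> B \<and> length as = n \<and> w = word as" using weyl_word[OF assms] by blast
  from LeastI_ex[OF this] show ?thesis using that unfolding weyl_length_def word_def by blast
qed

lemma weyl_length_le: "set as \<subseteq> B \<Longrightarrow> weyl_length B (word as) \<le> length as"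
  unfolding weyl_length_def word_def by (rule Least_le) blast

text \<open>The strong exchange property, for an arbitrary positive root p. Reading the word from
  the right, p turns negative at some letter; just before, its image equals that letter, by
  \<open>simple_reflection_pos\<close>, and composing with the reflection in p deletes the
  letter.\<close>

lemma word_exchange:
  assumes "set as \<subseteq> B" "p \<in> P" "word as p \<notin> P"
  shows "\<exists>bs. set bs \<subseteq> B \<and> length bs < length as \<and> word as \<circ> reflection p = word bs"
  using assms
proof (induction as)
  case Nil
  then show ?case by simp
next
  case (Cons a as)
  have w: "word as \<in> W" using Cons.prems(1) word_weyl by simp
  show ?case
  proof (cases "word as p \<in> P")
    case True
    have "reflection a (word as p) \<notin> P" "a \<in> B" using Cons.prems by simp_all
    then have a: "word as p = a" using simple_reflection_pos[OF True] by blast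
    have "word (a # as) \<circ> reflection p = reflection a \<circ> (word as \<circ> reflection p)"
      by (simp add: comp_assoc)
    also have "word as \<circ> reflection p = reflection a \<circ> word as"
      using weyl_reflection_conj[OF w pos_root[OF Cons.prems(2)]] a by simp
    also have "reflection a \<circ> (reflection a \<circ> word as) = word as"
      using Cons.prems(1) by (auto simp: fun_eq_iff reflection_invol base_root)
    finally show ?thesis using Cons.prems(1) by auto
  next
    case False
    then obtain bs where bs: "set bs \<subseteq> B" "length bs < length as" "word as \<circ> reflection p = word bs"
      using Cons by (meson set_subset_Cons subset_trans)
    then have "word (a # as) \<circ> reflection p = word (a # bs)"
      by (simp only: word_Cons comp_assoc)
    moreover have "set (a # bs) \<subseteq> B" "length (a # bs) < length (a # as)"
      using Cons.prems(1) bs by simp_all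
    ultimately show ?thesis by blast
  qed
qed

lemma weyl_length_exchange:
  assumes "w \<in> W" "p \<in> P" "w p \<notin> P"
  shows "weyl_length B (w \<circ> reflection p) < weyl_length B w"
proof -
  obtain as where as: "set as \<subseteq> B" "length as = weyl_length B w" "w = word as"
    using weyl_shortest_word[OF assms(1)] by blast
  then obtain bs where "set bs \<subseteq> B" "length bs < length as" "w \<circ> reflection p = word bs"
    using word_exchange[OF as(1) assms(2)] assms(3) by auto
  then show ?thesis using weyl_length_le[of bs] as(2) by simp
qed

text \<open>Otherwise a shortest word of w ends in some simple b, and the word without it sends b to
  a negative root, so that the exchange property contradicts minimality.\<close>

lemma weyl_eq_id:
  assumes w: "w \<in> W" and pos: "\<And>b. b \<in> B \<Longrightarrow> w b \<in> P"
  shows "w = id"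
proof -
  obtain as where as: "set as \<subseteq> B" "length as = weyl_length B w" "w = word as"
    using weyl_shortest_word[OF w] by blast
  show ?thesis
  proof (cases as rule: rev_cases)
    case Nil
    then show ?thesis using as by simp
  next
    case (snoc cs b)
    have b: "b \<in> B" and cs: "set cs \<subseteq> B" using as(1) snoc by auto
    have eq: "word cs \<circ> reflection b = w" using as(3) snoc by (simp add: word_append)
    then have "w b = - word cs b"
      using weyl_simps(3)[OF word_weyl[OF cs]] base_root[OF b] by (auto simp: reflection_self)
    then have "word cs b \<notin> P"
      using pos[OF b] weyl_neg_pos_iff[OF word_weyl[OF cs] base_root[OF b]] by simp
    then have "weyl_length B w < weyl_length B (word cs)"
      using weyl_length_exchange[OF word_weyl[OF cs] base_pos[OF b]] eq by simp
    then show ?thesis using weyl_length_le[OF cs] as(2) snoc by simp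
  qed
qed

section \<open>Dominant roots and the highest root\<close>

text \<open>In the simply-laced case two nonorthogonal roots are conjugate under their own two
  reflections, so an orbit is orthogonal to its complement; by irreducibility there is only one
  orbit.\<close>

lemma weyl_transitive:
  assumes "\<gamma> \<in> \<Delta>" "\<mu> \<in> \<Delta>" shows "\<exists>w\<in>W. w \<gamma> = \<mu>"
proof (rule ccontr)
  assume neg: "\<not> ?thesis"
  define X where "X = {w \<gamma> | w. w \<in> W}"
  have X: "X \<subseteq> \<Delta>" using weyl_root assms by (auto simp: X_def)
  have refl: "reflection \<beta> x \<in> X" if x: "x \<in> X" and \<beta>: "\<beta> \<in> \<Delta>" for x \<beta>
  proof -
    obtain w where w: "w \<in> W" "x = w \<gamma>" using x by (auto simp: X_def)
    then have "reflection \<beta> x = (reflection \<beta> \<circ> w) \<gamma>" "reflection \<beta> \<circ> w \<in> W"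
      using weyl_step[OF \<beta>] by auto
    then show ?thesis unfolding X_def by blast
  qed
  have minus: "- x \<in> X" if "x \<in> X" for x
    using refl[OF that] X that reflection_self by fastforce
  have "\<alpha> \<cdot> \<beta> = 0" if ab: "\<alpha> \<in> X" "\<beta> \<in> \<Delta> - X" for \<alpha> \<beta>
  proof (rule ccontr)
    assume nz: "\<alpha> \<cdot> \<beta> \<noteq> 0"
    have r: "\<alpha> \<in> \<Delta>" "\<beta> \<in> \<Delta>" using ab X by auto
    have "\<alpha> \<noteq> \<beta>" "\<alpha> \<noteq> - \<beta>" using ab minus by force+
    then consider "\<alpha> \<cdot> \<beta> = 1" | "\<alpha> \<cdot> \<beta> = -1" using pairing_cases[OF r] nz by auto
    then have "\<beta> \<in> X"
    proof cases
      case 1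
      have "\<alpha> - \<beta> \<in> X" using refl[OF ab(1) r(2)] 1 r by (simp add: reflection_pairing)
      from refl[OF this r(1)] have "- \<beta> \<in> X"
        using 1 r by (simp add: reflection_pairing pairing_self pairing_commute[of \<beta> \<alpha>])
      from minus[OF this] show ?thesis by simp
    next
      case 2
      have "\<alpha> + \<beta> \<in> X" using refl[OF ab(1) r(2)] 2 r by (simp add: reflection_pairing)
      from refl[OF this r(1)] show ?thesis
        using 2 r by (simp add: reflection_pairing pairing_self pairing_commute[of \<beta> \<alpha>])
    qed
    then show False using ab by simp
  qed
  then have "\<forall>\<alpha>\<in>X. \<forall>\<beta>\<in>\<Delta> - X. \<alpha> \<bullet> \<beta> = 0" using N_pos by (simp add: pairing_def)
  moreover have "id \<gamma> \<in> X" unfolding X_def using weyl_id by blast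
  moreover have "\<mu> \<in> \<Delta> - X" using neg assms by (auto simp: X_def)
  moreover have "X \<union> (\<Delta> - X) = \<Delta>" using X by auto
  ultimately show False
    using irreducible unfolding irreducible_root_system_def by (metis Diff_disjoint empty_iff)
qed

text \<open>Two dominant vectors of one orbit agree: a simple b made negative by w must be
  orthogonal to x, so its reflection can be removed from w.\<close>

lemma dominant_weyl_unique:
  assumes "w \<in> W" "w x = y" "\<And>b. b \<in> B \<Longrightarrow> x \<cdot> b \<ge> 0" "\<And>b. b \<in> B \<Longrightarrow> y \<cdot> b \<ge> 0"
  shows "x = y"
  using assms(1,2)
proof (induction "weyl_length B w" arbitrary: w rule: less_induct)
  case less
  show ?case
  proof (cases "w = id")
    case True
    then show ?thesis using less by simp
  next
    case False
    then obtain b where b: "b \<in> B" "w b \<notin> P" using weyl_eq_id less.prems by blast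
    have "- w b \<in> P" using weyl_neg_pos_iff less.prems(1) b base_root by blast
    then have "y \<cdot> (- w b) \<ge> 0" using nn_pairing_nonneg[OF pos_nn] assms(4) by blast
    moreover have "y \<cdot> w b = x \<cdot> b" using weyl_isometry[OF less.prems(1), of x b] less.prems(2) by simp
    ultimately have "x \<cdot> b = 0" using assms(3)[OF b(1)] by simp
    then have "(w \<circ> reflection b) x = y" using less.prems(2) b(1) by (simp add: reflection_pairing base_root)
    moreover have "w \<circ> reflection b \<in> W" using less.prems(1) b(1) by (simp add: weyl_comp weyl_reflection base_root)
    moreover have "weyl_length B (w \<circ> reflection b) < weyl_length B w"
      using weyl_length_exchange less.prems(1) b base_pos by blast
    ultimately show ?thesis using less.hyps by blast
  qed
qed

text \<open>Simple reflections that raise the height lead to a dominant root.\<close>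

lemma ex_dominant_above:
  assumes "\<gamma> \<in> \<Delta>" shows "\<exists>\<mu>\<in>\<Delta>. (\<forall>b\<in>B. \<mu> \<cdot> b \<ge> 0) \<and> \<mu> - \<gamma> \<in> nn"
proof -
  let ?S = "{\<mu> \<in> \<Delta>. \<mu> - \<gamma> \<in> nn}"
  have "finite ?S" "?S \<noteq> {}" using assms finite_roots nn_zero by auto
  then have "Max (height ` ?S) \<in> height ` ?S" "\<And>x. x \<in> ?S \<Longrightarrow> height x \<le> Max (height ` ?S)"
    by (auto intro: Max_in Max_ge)
  then obtain \<mu> where m: "\<mu> \<in> ?S" "\<And>x. x \<in> ?S \<Longrightarrow> height x \<le> height \<mu>" by (metis (no_types, lifting) imageE)
  have "\<mu> \<cdot> b \<ge> 0" if b: "b \<in> B" for b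
  proof (rule ccontr)
    assume "\<not> \<mu> \<cdot> b \<ge> 0"
    then have "\<mu> \<cdot> b = -1 \<or> \<mu> \<cdot> b = -2" using pairing_cases[of \<mu> b] m(1) base_root[OF b] by auto
    then have r: "reflection b \<mu> = \<mu> + b \<or> reflection b \<mu> = \<mu> + (b + b)"
      using base_root[OF b] by (auto simp: reflection_pairing scaleR_2)
    then have "reflection b \<mu> - \<gamma> = (\<mu> - \<gamma>) + b \<or> reflection b \<mu> - \<gamma> = (\<mu> - \<gamma>) + (b + b)" by auto
    moreover have "(\<mu> - \<gamma>) + b \<in> nn" "(\<mu> - \<gamma>) + (b + b) \<in> nn"
      using m(1) nn_base[OF b] nn_add by blast+
    ultimately have "reflection b \<mu> - \<gamma> \<in> nn" by metis
    then have "reflection b \<mu> \<in> ?S" using m(1) reflection_root base_root[OF b] by simp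
    from m(2)[OF this] r height_base[OF b] show False by auto
  qed
  then show ?thesis using m(1) by blast
qed

text \<open>Every root lies below some dominant root, and there is only one dominant root because
  all roots are conjugate.\<close>

lemma ex1_highest_root: "\<exists>!\<theta>. \<theta> \<in> \<Delta> \<and> (\<forall>\<gamma>\<in>\<Delta>. \<theta> - \<gamma> \<in> nn)"
proof (rule ex_ex1I)
  have "\<Delta> \<noteq> {}" using irreducible by (simp add: irreducible_root_system_def)
  then obtain \<gamma>0 where "\<gamma>0 \<in> \<Delta>" by blast
  from ex_dominant_above[OF this] obtain \<theta> where t: "\<theta> \<in> \<Delta>" "\<And>b. b \<in> B \<Longrightarrow> \<theta> \<cdot> b \<ge> 0" by blast
  have "\<theta> - \<gamma> \<in> nn" if g: "\<gamma> \<in> \<Delta>" for \<gamma>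
  proof -
    from ex_dominant_above[OF g] obtain \<mu>
      where m: "\<mu> \<in> \<Delta>" "\<And>b. b \<in> B \<Longrightarrow> \<mu> \<cdot> b \<ge> 0" "\<mu> - \<gamma> \<in> nn" by blast
    obtain w where "w \<in> W" "w \<theta> = \<mu>" using weyl_transitive[OF t(1) m(1)] by blast
    then have "\<theta> = \<mu>" using dominant_weyl_unique t(2) m(2) by blast
    then show ?thesis using m(3) by simp
  qed
  then show "\<exists>\<theta>. \<theta> \<in> \<Delta> \<and> (\<forall>\<gamma>\<in>\<Delta>. \<theta> - \<gamma> \<in> nn)" using t(1) by blast
next
  fix x y assume "x \<in> \<Delta> \<and> (\<forall>\<gamma>\<in>\<Delta>. x - \<gamma> \<in> nn)" "y \<in> \<Delta> \<and> (\<forall>\<gamma>\<in>\<Delta>. y - \<gamma> \<in> nn)"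
  then have "x - y \<in> nn" "- (x - y) \<in> nn" by auto
  then show "x = y" using nn_antisym by fastforce
qed

lemma highest_root: "highest_root \<Delta> B \<in> \<Delta>" "\<gamma> \<in> \<Delta> \<Longrightarrow> highest_root \<Delta> B - \<gamma> \<in> nn"
  using theI'[OF ex1_highest_root] unfolding highest_root_def by auto

lemma highest_root_dominant:
  assumes "b \<in> B" shows "highest_root \<Delta> B \<cdot> b \<ge> 0"
proof -
  obtain \<mu> where m: "\<mu> \<in> \<Delta>" "\<forall>b\<in>B. \<mu> \<cdot> b \<ge> 0" "\<mu> - highest_root \<Delta> B \<in> nn"
    using ex_dominant_above[OF highest_root(1)] by blast
  have "\<mu> = highest_root \<Delta> B" using nn_antisym[OF m(3)] highest_root(2)[OF m(1)] by simp
  then show ?thesis using m(2) assms by blast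
qed

text \<open>If \<theta> were negative, then adding - \<theta> to \<theta> - (- \<theta>) would make
  \<theta> positive.\<close>

lemma highest_root_pos: "highest_root \<Delta> B \<in> P"
proof (rule posI[OF highest_root(1)])
  let ?\<theta> = "highest_root \<Delta> B"
  show "?\<theta> \<in> nn"
  proof (rule ccontr)
    assume n: "?\<theta> \<notin> nn"
    then have "- ?\<theta> \<in> nn" using root_sign highest_root(1) by blast
    have "?\<theta> - - ?\<theta> \<in> nn" using highest_root(1) by (intro highest_root(2)) simp
    from nn_add[OF this \<open>- ?\<theta> \<in> nn\<close>] n show False by simp
  qed
qed

lemma highest_root_pairing_nonneg: "p \<in> nn \<Longrightarrow> highest_root \<Delta> B \<cdot> p \<ge> 0"
  using nn_pairing_nonneg highest_root_dominant by blast

section \<open>Elements of minimal length\<close>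

text \<open>This property picks the shortest elements from the cosets of the stabiliser of \<gamma>;
  unlike the length, it can be tested on roots.\<close>

definition reduced :: "('a \<Rightarrow> 'a) \<Rightarrow> 'a \<Rightarrow> bool" where
  "reduced w \<gamma> \<longleftrightarrow> (\<forall>p\<in>P. p \<cdot> \<gamma> = 0 \<longrightarrow> w p \<in> P)"

lemma reducedD: "reduced w \<gamma> \<Longrightarrow> p \<in> P \<Longrightarrow> p \<cdot> \<gamma> = 0 \<Longrightarrow> w p \<in> P"
  by (simp add: reduced_def)

lemma shortest_reduced:
  assumes w: "w \<in> W" "w \<gamma> = \<alpha>"
    and short: "\<And>v. v \<in> W \<Longrightarrow> v \<gamma> = \<alpha> \<Longrightarrow> weyl_length B w \<le> weyl_length B v"
  shows "reduced w \<gamma>"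
  unfolding reduced_def
proof (intro ballI impI)
  fix p assume p: "p \<in> P" "p \<cdot> \<gamma> = 0"
  note r = pos_root[OF p(1)]
  show "w p \<in> P"
  proof (rule ccontr)
    assume "w p \<notin> P"
    then have "weyl_length B (w \<circ> reflection p) < weyl_length B w"
      using weyl_length_exchange w(1) p(1) by blast
    moreover have "(w \<circ> reflection p) \<gamma> = \<alpha>"
      using w(2) p r by (simp add: reflection_pairing pairing_commute[of \<gamma> p])
    moreover have "w \<circ> reflection p \<in> W" using w(1) r by (simp add: weyl_comp weyl_reflection)
    ultimately show False using short by fastforce
  qed
qed

lemma ex_shortest:
  assumes "\<gamma> \<in> \<Delta>" "\<alpha> \<in> \<Delta>"
  shows "\<exists>w. w \<in> W \<and> w \<gamma> = \<alpha> \<and> (\<forall>v\<in>W. v \<gamma> = \<alpha> \<longrightarrow> weyl_length B w \<le> weyl_length B v)"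
proof -
  obtain w0 where "w0 \<in> W \<and> w0 \<gamma> = \<alpha>" using weyl_transitive[OF assms] by blast
  from ex_has_least_nat[of "\<lambda>w. w \<in> W \<and> w \<gamma> = \<alpha>", OF this, of "weyl_length B"]
  show ?thesis by blast
qed

lemma reduced_inverse:
  assumes w: "w \<in> W" "w \<gamma> = \<alpha>" "reduced w \<gamma>" and q: "q \<in> \<Delta>" "w q \<in> P" "w q \<cdot> \<alpha> = 0"
  shows "q \<in> P" "q \<cdot> \<gamma> = 0"
proof -
  show o: "q \<cdot> \<gamma> = 0" using q(3) w(2) weyl_isometry[OF w(1), of q \<gamma>] by simp
  show "q \<in> P"
  proof (rule ccontr)
    assume "q \<notin> P"
    then have "- q \<in> P" using neg_pos_iff[OF q(1)] by simp
    from reducedD[OF w(3) this] o have "w (- q) \<in> P" by simp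
    then show False using q w(1) by (simp add: weyl_simps neg_pos_iff weyl_root)
  qed
qed

text \<open>The two elements are compared after composing them with a reduced element u from
  \<alpha> to \<theta>. The quotient x of the two compositions fixes \<theta> and keeps positive the
  positive roots orthogonal to \<theta>. A simple root made negative by it would be orthogonal to
  \<theta>, since \<theta> is dominant; so x is the identity.\<close>

lemma reduced_unique:
  assumes r: "\<gamma> \<in> \<Delta>" "\<alpha> \<in> \<Delta>"
    and w: "w \<in> W" "w \<gamma> = \<alpha>" "reduced w \<gamma>"
    and v: "v \<in> W" "v \<gamma> = \<alpha>" "reduced v \<gamma>"
  shows "w = v"
proof -
  let ?\<theta> = "highest_root \<Delta> B"
  obtain u where u: "u \<in> W" "u \<alpha> = ?\<theta>" "reduced u \<alpha>"
    using ex_shortest[OF r(2) highest_root(1)] shortest_reduced by blast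
  obtain w' where w': "w' \<in> W" "\<And>x. w' (w x) = x" "\<And>x. w (w' x) = x"
    using weyl_inverseE[OF w(1)] by blast
  obtain u' where u': "u' \<in> W" "\<And>x. u' (u x) = x" "\<And>x. u (u' x) = x"
    using weyl_inverseE[OF u(1)] by blast
  define x where "x = u \<circ> (v \<circ> (w' \<circ> u'))"
  have xW: "x \<in> W" unfolding x_def using u(1) v(1) w'(1) u'(1) by (intro weyl_comp)
  have x\<theta>: "x ?\<theta> = ?\<theta>"
    unfolding x_def comp_apply using u(2) u'(2)[of \<alpha>] w'(2)[of \<gamma>] w(2) v(2) by simp
  have "x = id"
  proof (rule weyl_eq_id[OF xW])
    fix b assume b: "b \<in> B"
    note bP = base_pos[OF b] and b\<Delta> = base_root[OF b]
    show "x b \<in> P"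
    proof (rule ccontr)
      assume neg: "x b \<notin> P"
      then have "- x b \<in> P" using weyl_neg_pos_iff[OF xW b\<Delta>] by simp
      from nn_pairing_nonneg[OF pos_nn[OF this] highest_root_dominant]
      have "?\<theta> \<cdot> (- x b) \<ge> 0" .
      then have "b \<cdot> ?\<theta> = 0"
        using weyl_isometry[OF xW, of ?\<theta> b] x\<theta> highest_root_dominant[OF b]
        by (simp add: pairing_commute[of b])
      then have 1: "u' b \<in> P" "u' b \<cdot> \<alpha> = 0"
        using reduced_inverse[OF u, of "u' b"] bP weyl_root[OF u'(1) b\<Delta>] u'(3)[of b] by auto
      then have 2: "w' (u' b) \<in> P" "w' (u' b) \<cdot> \<gamma> = 0"
        using reduced_inverse[OF w, of "w' (u' b)"] weyl_root[OF w'(1) pos_root] w'(3) by auto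
      then have 3: "v (w' (u' b)) \<in> P" by (rule reducedD[OF v(3)])
      have "v (w' (u' b)) \<cdot> \<alpha> = 0" using 2(2) weyl_isometry[OF v(1), of "w' (u' b)" \<gamma>] v(2) by simp
      from reducedD[OF u(3) 3 this] neg show False by (simp add: x_def)
    qed
  qed
  then have "u (v (w' (u' (u (w y))))) = u (w y)" for y by (simp add: x_def fun_eq_iff)
  then have "u (v y) = u (w y)" for y using u'(2) w'(2) by simp
  then have "v y = w y" for y using u'(2) by metis
  then show ?thesis by auto
qed

text \<open>Shortest elements exist by conjugacy of the roots and are reduced, hence unique.\<close>

lemma min_element:
  assumes r: "\<gamma> \<in> \<Delta>" "\<alpha> \<in> \<Delta>"
  shows "min_element \<Delta> B \<gamma> \<alpha> \<in> W" "min_element \<Delta> B \<gamma> \<alpha> \<gamma> = \<alpha>"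
    "reduced (min_element \<Delta> B \<gamma> \<alpha>) \<gamma>"
proof -
  let ?Q = "\<lambda>w. w \<in> W \<and> w \<gamma> = \<alpha> \<and> (\<forall>v\<in>W. v \<gamma> = \<alpha> \<longrightarrow> weyl_length B w \<le> weyl_length B v)"
  have "\<exists>!w. ?Q w"
  proof (rule ex_ex1I)
    show "\<exists>w. ?Q w" by (rule ex_shortest[OF r])
    show "w = v" if "?Q w" "?Q v" for w v
      by (rule reduced_unique[OF r]) (use that in \<open>auto intro!: shortest_reduced\<close>)
  qed
  from theI'[OF this] have m: "?Q (min_element \<Delta> B \<gamma> \<alpha>)" unfolding min_element_def .
  then show "min_element \<Delta> B \<gamma> \<alpha> \<in> W" "min_element \<Delta> B \<gamma> \<alpha> \<gamma> = \<alpha>" by auto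
  then show "reduced (min_element \<Delta> B \<gamma> \<alpha>) \<gamma>" using m by (intro shortest_reduced) auto
qed

lemma min_element_eq:
  assumes "\<gamma> \<in> \<Delta>" "\<alpha> \<in> \<Delta>" "w \<in> W" "w \<gamma> = \<alpha>" "reduced w \<gamma>"
  shows "min_element \<Delta> B \<gamma> \<alpha> = w"
  using reduced_unique[OF assms(1,2) min_element[OF assms(1,2)] assms(3-5)] .


section \<open>The root lattice\<close>

definition root_lattice :: "'a set" where
  "root_lattice = {sum_list l | l. set l \<subseteq> \<Delta>}"

lemma root_latticeI: "set l \<subseteq> \<Delta> \<Longrightarrow> sum_list l \<in> root_lattice"
  unfolding root_lattice_def by blast

lemma root_lattice_zero: "0 \<in> root_lattice"
  unfolding root_lattice_def by (auto intro!: exI[of _ "[]"])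

lemma root_lattice_root: "\<gamma> \<in> \<Delta> \<Longrightarrow> \<gamma> \<in> root_lattice"
  unfolding root_lattice_def by (auto intro!: exI[of _ "[\<gamma>]"])

lemma root_lattice_add: assumes "s \<in> root_lattice" "t \<in> root_lattice" shows "s + t \<in> root_lattice"
proof -
  obtain k l where "set k \<subseteq> \<Delta>" "set l \<subseteq> \<Delta>" "s = sum_list k" "t = sum_list l"
    using assms unfolding root_lattice_def by auto
  then show ?thesis unfolding root_lattice_def by (auto intro!: exI[of _ "k @ l"])
qed

lemma root_lattice_uminus: assumes "s \<in> root_lattice" shows "- s \<in> root_lattice"
proof -
  obtain l where l: "set l \<subseteq> \<Delta>" "s = sum_list l"
    using assms unfolding root_lattice_def by auto
  have "- sum_list l = sum_list (map uminus l)" by (induction l) auto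
  moreover have "set (map uminus l) \<subseteq> \<Delta>" using l(1) uminus_root by auto
  ultimately show ?thesis using l(2) root_latticeI by metis
qed

lemma root_lattice_weyl: assumes "w \<in> W" "s \<in> root_lattice" shows "w s \<in> root_lattice"
proof -
  obtain l where l: "set l \<subseteq> \<Delta>" "s = sum_list l"
    using assms unfolding root_lattice_def by auto
  have "w (sum_list l) = sum_list (map w l)" by (induction l) (auto simp: weyl_simps[OF assms(1)])
  moreover have "set (map w l) \<subseteq> \<Delta>" using l(1) weyl_root[OF assms(1)] by auto
  ultimately show ?thesis using l(2) root_latticeI by metis
qed

lemma pairing_sum_list: "z \<cdot> sum_list l = (\<Sum>x\<leftarrow>l. z \<cdot> x)"
  by (induction l) auto

lemma root_lattice_pairing_Ints:
  assumes "\<gamma> \<in> \<Delta>" "s \<in> root_lattice" shows "\<gamma> \<cdot> s \<in> \<int>"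
proof -
  obtain l where l: "set l \<subseteq> \<Delta>" "s = sum_list l"
    using assms unfolding root_lattice_def by auto
  have "\<gamma> \<cdot> sum_list l \<in> \<int>" using l(1)
    by (induction l) (auto intro!: Ints_add pairing_Ints assms(1))
  then show ?thesis using l(2) by simp
qed

text \<open>Otherwise s pairs to 1 with one of its own summands. Subtracting that summand is the
  same as reflecting s in it, so the result is again minuscule and a sum of fewer roots.\<close>

lemma minuscule_root_lattice:
  assumes "s \<in> root_lattice" "\<And>\<gamma>. \<gamma> \<in> \<Delta> \<Longrightarrow> \<gamma> \<cdot> s \<le> 1" shows "s = 0"
proof -
  have "sum_list l = 0" if "set l \<subseteq> \<Delta>" "\<And>\<gamma>. \<gamma> \<in> \<Delta> \<Longrightarrow> \<gamma> \<cdot> sum_list l \<le> 1" for l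
    using that
  proof (induction "length l" arbitrary: l)
    case 0
    then show ?case by simp
  next
    case (Suc n)
    let ?s = "sum_list l"
    show ?case
    proof (rule ccontr)
      assume nz: "?s \<noteq> 0"
      have "\<exists>g\<in>set l. ?s \<cdot> g > 0"
      proof (rule ccontr)
        assume "\<not> ?thesis"
        then have "(\<Sum>x\<leftarrow>l. ?s \<cdot> x) \<le> 0" by (intro sum_list_nonpos) (auto simp: not_less)
        then have "?s \<cdot> ?s \<le> 0" by (simp add: pairing_sum_list)
        then show False using pairing_nonneg[of ?s] pairing_eq_0_imp[of ?s] nz by linarith
      qed
      then obtain g where g: "g \<in> set l" "?s \<cdot> g > 0" by blast
      have r: "g \<in> \<Delta>" using g Suc.prems by auto
      have "g \<cdot> ?s \<in> \<int>" using r Suc.prems(1) root_lattice_pairing_Ints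
        unfolding root_lattice_def by blast
      then have one: "?s \<cdot> g = 1"
        using g(2) Suc.prems(2)[OF r] by (auto simp: pairing_commute[of g] elim!: Ints_cases)
      have rem: "sum_list (remove1 g l) = ?s - g"
        using sum_list_map_remove1[OF g(1), of "\<lambda>x. x"] by simp
      have refl: "?s - g = reflection g ?s" using r one by (simp add: reflection_pairing)
      have "sum_list (remove1 g l) = 0"
      proof (rule Suc.hyps(1))
        show "n = length (remove1 g l)" using Suc.hyps(2) g(1) by (simp add: length_remove1)
        show "set (remove1 g l) \<subseteq> \<Delta>" using Suc.prems(1) set_remove1_subset by fast
        fix \<gamma> assume \<gamma>: "\<gamma> \<in> \<Delta>"
        have "\<gamma> \<cdot> reflection g ?s = reflection g \<gamma> \<cdot> ?s"
          using reflection_isometry[OF r, of "reflection g \<gamma>" ?s] by (simp add: reflection_invol r)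
        then show "\<gamma> \<cdot> sum_list (remove1 g l) \<le> 1"
          unfolding rem refl using Suc.prems(2) reflection_root[OF r \<gamma>] by simp
      qed
      then have "?s = g" using rem by simp
      then show False using one pairing_self[OF r] by simp
    qed
  qed
  then show ?thesis using assms unfolding root_lattice_def by auto
qed

section \<open>The affine Weyl group\<close>

abbreviation PA where "PA \<equiv> pos_affine_roots \<Delta> B"

definition affine_map :: "('a \<Rightarrow> 'a) \<Rightarrow> 'a \<Rightarrow> 'a \<times> real \<Rightarrow> 'a \<times> real" where
  "affine_map g s q = (g (fst q), snd q + fst q \<cdot> s)"

lemma affine_map_Pair [simp]: "affine_map g s (x, c) = (g x, c + x \<cdot> s)"
  by (simp add: affine_map_def)

text \<open>A group containing the affine Weyl group, in which products, inverses and the effect on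
  levels are explicit.\<close>

definition affine_maps :: "('a \<times> real \<Rightarrow> 'a \<times> real) set" where
  "affine_maps = {affine_map g s | g s. g \<in> W \<and> s \<in> root_lattice}"

lemma affine_maps_comp:
  assumes "u \<in> affine_maps" "w \<in> affine_maps" shows "u \<circ> w \<in> affine_maps"
proof -
  obtain g s h t where gs: "u = affine_map g s" "g \<in> W" "s \<in> root_lattice"
    "w = affine_map h t" "h \<in> W" "t \<in> root_lattice"
    using assms unfolding affine_maps_def by auto
  obtain h' where h': "h' \<in> W" "\<And>x. h' (h x) = x" "\<And>x. h (h' x) = x"
    using weyl_inverseE[OF gs(5)] by blast
  have "h x \<cdot> s = x \<cdot> h' s" for x using weyl_isometry[OF gs(5), of x "h' s"] h'(3) by simp
  then have "u \<circ> w = affine_map (g \<circ> h) (t + h' s)" unfolding gs by (auto simp: fun_eq_iff)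
  moreover have "g \<circ> h \<in> W" "t + h' s \<in> root_lattice"
    using gs h'(1) by (auto intro: weyl_comp root_lattice_add root_lattice_weyl)
  ultimately show ?thesis unfolding affine_maps_def by blast
qed

lemma affine_maps_inverseE:
  assumes "w \<in> affine_maps"
  obtains v where "v \<in> affine_maps" "\<And>q. v (w q) = q" "\<And>q. w (v q) = q"
proof -
  obtain g s where gs: "w = affine_map g s" "g \<in> W" "s \<in> root_lattice"
    using assms unfolding affine_maps_def by auto
  obtain h where h: "h \<in> W" "\<And>x. h (g x) = x" "\<And>x. g (h x) = x"
    using weyl_inverseE[OF gs(2)] by blast
  let ?v = "affine_map h (- g s)"
  have "?v \<in> affine_maps" unfolding affine_maps_def
    using h(1) gs by (auto intro: root_lattice_weyl root_lattice_uminus)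
  moreover have "?v (w q) = q" for q
    by (cases q) (simp add: gs(1) h weyl_isometry[OF gs(2)])
  moreover have "w (?v q) = q" for q
    using weyl_isometry[OF gs(2), of "h (fst q)" s] by (cases q) (simp add: gs(1) h)
  ultimately show ?thesis using that by blast
qed

lemma affine_maps_simps:
  assumes "w \<in> affine_maps"
  shows "w (p + q) = w p + w q" "w (p - q) = w p - w q" "w (- p) = - w p" "w (0, c) = (0, c)"
  using assms unfolding affine_maps_def
  by (cases p; cases q; auto simp: weyl_simps)+

lemma affine_reflection_finite: "\<gamma> \<in> \<Delta> \<Longrightarrow> affine_reflection (\<gamma>, 0) = affine_map (reflection \<gamma>) 0"
  by (auto simp: fun_eq_iff affine_reflection_def reflection_def)

lemma alpha0: "alpha0 \<Delta> B = (- highest_root \<Delta> B, 1)"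
  by (simp add: alpha0_def basic_imaginary_root_def)

lemma affine_reflection_alpha0:
  "affine_reflection (alpha0 \<Delta> B) = affine_map (reflection (highest_root \<Delta> B)) (highest_root \<Delta> B)"
  by (auto simp: fun_eq_iff affine_reflection_def reflection_def alpha0 pairing_def sq_norm highest_root)

lemma affine_weyl_affine_maps: "w \<in> affine_weyl_group \<Delta> B \<Longrightarrow> w \<in> affine_maps"
proof (induction rule: affine_weyl_group.induct)
  case affine_id
  have "id = affine_map id 0" by (auto simp: fun_eq_iff)
  then show ?case unfolding affine_maps_def using weyl_id root_lattice_zero by blast
next
  case (affine_finite_step \<gamma> w)
  have "affine_reflection (\<gamma>, 0) \<in> affine_maps" unfolding affine_maps_def
    using affine_finite_step.hyps affine_reflection_finite weyl_reflection root_lattice_zero by blast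
  then show ?case using affine_finite_step.IH affine_maps_comp by blast
next
  case (affine_zero_step w)
  have "affine_reflection (alpha0 \<Delta> B) \<in> affine_maps" unfolding affine_maps_def
    using affine_reflection_alpha0 weyl_reflection root_lattice_root highest_root(1) by blast
  then show ?case using affine_zero_step.IH affine_maps_comp by blast
qed

lemma weyl_affine_weyl:
  assumes "v \<in> W" "w \<in> affine_weyl_group \<Delta> B" shows "affine_map v 0 \<circ> w \<in> affine_weyl_group \<Delta> B"
  using assms(1)
proof (induction rule: weyl_group.induct)
  case weyl_id
  have "affine_map id 0 = id" by (auto simp: fun_eq_iff)
  then show ?case using assms(2) by (simp only: id_comp)
next
  case (weyl_step \<gamma> v)
  have "affine_map (reflection \<gamma> \<circ> v) 0 = affine_reflection (\<gamma>, 0) \<circ> affine_map v 0"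
    by (auto simp: fun_eq_iff affine_reflection_finite weyl_step.hyps)
  then show ?case using affine_finite_step[OF weyl_step.hyps(1) weyl_step.IH] by (simp only: comp_assoc)
qed

lemma PA_iff: "(x, c) \<in> PA \<longleftrightarrow> x \<in> \<Delta> \<and> c \<in> \<int> \<and> (c > 0 \<or> c = 0 \<and> x \<in> P)"
  unfolding pos_affine_roots_def by (auto elim!: Ints_cases)

definition affine_roots :: "('a \<times> real) set" where "affine_roots = \<Delta> \<times> \<int>"

lemma affine_roots_iff [simp]: "(x, c) \<in> affine_roots \<longleftrightarrow> x \<in> \<Delta> \<and> c \<in> \<int>"
  by (simp add: affine_roots_def)

lemma PA_affine_roots: "q \<in> PA \<Longrightarrow> q \<in> affine_roots"
  by (cases q) (simp add: PA_iff)

lemma neg_PA_iff: "q \<in> affine_roots \<Longrightarrow> - q \<in> PA \<longleftrightarrow> q \<notin> PA"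
  by (cases q) (auto simp: PA_iff neg_pos_iff)

lemma affine_maps_roots: "w \<in> affine_maps \<Longrightarrow> q \<in> affine_roots \<Longrightarrow> w q \<in> affine_roots"
  unfolding affine_maps_def
  by (cases q) (auto simp: weyl_root root_lattice_pairing_Ints intro!: Ints_add)

text \<open>The translation part s of such an element is minuscule, because u sends \<gamma> and
  \<delta> - \<gamma> to positive roots for every positive \<gamma>; hence s vanishes, and the
  finite part has no inversions.\<close>

lemma affine_maps_pos_id:
  assumes "u \<in> affine_maps" "\<And>q. q \<in> PA \<Longrightarrow> u q \<in> PA" shows "u = id"
proof -
  obtain g s where gs: "u = affine_map g s" "g \<in> W" "s \<in> root_lattice"
    using assms(1) unfolding affine_maps_def by auto
  have "0 \<le> \<gamma> \<cdot> s \<and> \<gamma> \<cdot> s \<le> 1" if p: "\<gamma> \<in> P" for \<gamma>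
  proof -
    have "(\<gamma>, 0) \<in> PA" "(- \<gamma>, 1) \<in> PA" using p pos_root by (auto simp: PA_iff)
    then have "u (\<gamma>, 0) \<in> PA" "u (- \<gamma>, 1) \<in> PA" using assms(2) by blast+
    then show ?thesis by (auto simp: gs(1) PA_iff)
  qed
  note b = this
  have "\<gamma> \<cdot> s \<le> 1" if "\<gamma> \<in> \<Delta>" for \<gamma>
    using b[of \<gamma>] b[of "- \<gamma>"] neg_pos_iff[OF that] by fastforce
  then have s: "s = 0" using minuscule_root_lattice gs(3) by blast
  have "g b \<in> P" if "b \<in> B" for b
    using assms(2)[of "(b, 0)"] base_pos[OF that] base_root[OF that] by (simp add: gs(1) s PA_iff)
  then have "g = id" using weyl_eq_id gs(2) by blast
  then show ?thesis by (auto simp: gs(1) s fun_eq_iff)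
qed

abbreviation inv_set where "inv_set \<equiv> affine_inversions \<Delta> B"

text \<open>If w1 and w2 have the same inversions, then w1 composed with the inverse of w2 preserves
  positivity.\<close>

lemma affine_maps_eqI:
  assumes "w1 \<in> affine_maps" "w2 \<in> affine_maps" "inv_set w1 = inv_set w2" shows "w1 = w2"
proof -
  obtain v where v: "v \<in> affine_maps" "\<And>q. v (w2 q) = q" "\<And>q. w2 (v q) = q"
    using affine_maps_inverseE[OF assms(2)] by blast
  have "w1 (v p) \<in> PA" if p: "p \<in> PA" for p
  proof -
    have r: "v p \<in> affine_roots" using affine_maps_roots v(1) PA_affine_roots p by blast
    show ?thesis
    proof (cases "v p \<in> PA")
      case True
      have "v p \<notin> inv_set w2"
        using p neg_PA_iff[OF PA_affine_roots] by (simp add: affine_inversions_def v(3))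
      then have "v p \<notin> inv_set w1" using assms(3) by simp
      then show ?thesis using True neg_PA_iff[OF affine_maps_roots[OF assms(1) r]]
        by (simp add: affine_inversions_def)
    next
      case False
      then have "- v p \<in> PA" using neg_PA_iff[OF r] by simp
      then have "- v p \<in> inv_set w2"
        using p by (simp add: affine_inversions_def v(3) affine_maps_simps[OF assms(2)])
      then have "- v p \<in> inv_set w1" using assms(3) by simp
      then show ?thesis by (simp add: affine_inversions_def affine_maps_simps[OF assms(1)])
    qed
  qed
  then have "w1 \<circ> v = id" using affine_maps_pos_id affine_maps_comp assms(1) v(1) by auto
  then show ?thesis using v(2) by (metis comp_apply id_apply ext)
qed

definition affine_simple :: "('a \<times> real) set" where
  "affine_simple = insert (alpha0 \<Delta> B) ((\<lambda>b. (b, 0)) ` B)"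

lemma affine_simple_PA: "z \<in> affine_simple \<Longrightarrow> z \<in> PA"
  using highest_root(1) base_root base_pos by (auto simp: affine_simple_def alpha0 PA_iff)

lemma affine_reflection_simple:
  assumes "z \<in> affine_simple"
  shows "affine_reflection z \<in> affine_maps" "affine_reflection z z = - z"
    "w \<in> affine_weyl_group \<Delta> B \<Longrightarrow> affine_reflection z \<circ> w \<in> affine_weyl_group \<Delta> B"
proof -
  have step: "affine_reflection z \<circ> w \<in> affine_weyl_group \<Delta> B" if "w \<in> affine_weyl_group \<Delta> B" for w
    using assms that by (auto simp: affine_simple_def intro: affine_finite_step affine_zero_step base_root)
  from this[OF affine_id] show "affine_reflection z \<in> affine_maps"
    by (simp add: affine_weyl_affine_maps)
  show "w \<in> affine_weyl_group \<Delta> B \<Longrightarrow> affine_reflection z \<circ> w \<in> affine_weyl_group \<Delta> B"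
    by (rule step)
  have "fst z \<in> \<Delta>" using affine_simple_PA[OF assms] by (cases z) (simp add: PA_iff)
  then show "affine_reflection z z = - z"
    using N_pos by (simp add: affine_reflection_def sq_norm scaleR_2)
qed

text \<open>For the affine node the only delicate roots are - \<theta> + c\<delta> and the roots x +
  \<delta> that drop to level zero, where x + \<theta> is positive because \<theta> is the highest
  root.\<close>

lemma affine_simple_reflection_PA:
  assumes z: "z \<in> affine_simple" and q: "q \<in> PA" "q \<noteq> z"
  shows "affine_reflection z q \<in> PA"
proof -
  obtain x c where xc: "q = (x, c)" by force
  have x: "x \<in> \<Delta>" "c \<in> \<int>" "c > 0 \<or> c = 0 \<and> x \<in> P" using q(1) by (auto simp: xc PA_iff)
  consider (finite) b where "b \<in> B" "z = (b, 0)" | (zero) "z = alpha0 \<Delta> B"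
    using z by (auto simp: affine_simple_def)
  then show ?thesis
  proof cases
    case finite
    then show ?thesis using x q(2) simple_reflection_pos[of x b]
      by (auto simp: xc affine_reflection_finite base_root PA_iff reflection_root)
  next
    case zero
    let ?\<theta> = "highest_root \<Delta> B"
    have eq: "affine_reflection z q = (reflection ?\<theta> x, c + x \<cdot> ?\<theta>)"
      unfolding zero affine_reflection_alpha0 xc by simp
    have i: "x \<cdot> ?\<theta> \<in> \<int>" using pairing_Ints x(1) highest_root(1) by blast
    have r: "reflection ?\<theta> x \<in> \<Delta>" using reflection_root x(1) highest_root(1) by blast
    have "c + x \<cdot> ?\<theta> > 0 \<or> c + x \<cdot> ?\<theta> = 0 \<and> reflection ?\<theta> x \<in> P"
    proof (cases "c = 0")
      case True
      then have "x \<in> P" using x(3) by simp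
      then have "x \<cdot> ?\<theta> \<ge> 0" using highest_root_pairing_nonneg pos_nn by (simp add: pairing_commute)
      then show ?thesis using True \<open>x \<in> P\<close>
        by (cases "x \<cdot> ?\<theta> = 0") (auto simp: reflection_pairing highest_root)
    next
      case False
      then have c: "c \<ge> 1" using x(2,3) by (auto elim!: Ints_cases)
      consider "x = - ?\<theta>" | "x \<noteq> - ?\<theta>" "x \<cdot> ?\<theta> \<ge> 0" | "x \<cdot> ?\<theta> = -1"
        using pairing_cases[OF x(1) highest_root(1)] by force
      then show ?thesis
      proof cases
        case 1
        then have "c \<noteq> 1" using q(2) by (auto simp: zero xc alpha0)
        then have "c \<ge> 2" using c x(2) by (auto elim!: Ints_cases)
        then show ?thesis using 1 highest_root(1) highest_root_pos
          by (auto simp: pairing_self reflection_pairing scaleR_2)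
      next
        case 2
        then show ?thesis using c by linarith
      next
        case 3
        then have "reflection ?\<theta> x = ?\<theta> - (- x)" by (simp add: reflection_pairing highest_root)
        then have "reflection ?\<theta> x \<in> P" using highest_root(2)[of "- x"] x(1) r posI by simp
        then show ?thesis using 3 c by linarith
      qed
    qed
    then show ?thesis unfolding eq PA_iff using r i x(2) by (auto intro: Ints_add)
  qed
qed

lemma affine_inversions_step:
  assumes w: "w \<in> affine_maps" and z: "z \<in> affine_simple" and r: "r \<in> PA" "w r = z"
  shows "inv_set (affine_reflection z \<circ> w) = insert r (inv_set w)"
proof -
  note zm = affine_reflection_simple(1,2)[OF z]
  have "- affine_reflection z (w q) \<in> PA \<longleftrightarrow> q = r \<or> - w q \<in> PA" if q: "q \<in> PA" for q
  proof (cases "q = r")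
    case True
    then show ?thesis using zm affine_simple_PA[OF z] r by simp
  next
    case False
    obtain v where v: "v \<in> affine_maps" "\<And>q. v (w q) = q" "\<And>q. w (v q) = q"
      using affine_maps_inverseE[OF w] by blast
    have n1: "w q \<noteq> z" using False v(2) r(2) by metis
    have "- w q \<noteq> z"
    proof
      assume "- w q = z"
      then have "w (- q) = w r" using r(2) by (simp add: affine_maps_simps[OF w])
      then have "- q = r" using v(2) by metis
      then show False using neg_PA_iff[OF PA_affine_roots[OF q]] q r(1) by simp
    qed
    note n2 = this
    have ar: "w q \<in> affine_roots" using affine_maps_roots[OF w PA_affine_roots[OF q]] .
    show ?thesis
    proof (cases "- w q \<in> PA")
      case True
      then show ?thesis using affine_simple_reflection_PA[OF z True n2]
        by (simp add: affine_maps_simps[OF zm(1)])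
    next
      case False': False
      then have "w q \<in> PA" using neg_PA_iff[OF ar] by simp
      then have "affine_reflection z (w q) \<in> PA" using affine_simple_reflection_PA[OF z _ n1] by simp
      then have "- affine_reflection z (w q) \<notin> PA" using neg_PA_iff[OF PA_affine_roots] by blast
      then show ?thesis using False False' by simp
    qed
  qed
  then show ?thesis unfolding affine_inversions_def using r(1) by auto
qed

text \<open>Subtracting \<delta> leaves a positive root unless the level is 0, or the level is 1 and
  the finite part negative. In these cases a simple root can be subtracted instead.\<close>

lemma affine_nonsimple_decomp:
  assumes q: "q \<in> PA" "q \<notin> affine_simple"
  shows "(\<exists>p\<in>PA. \<exists>p'\<in>PA. q = p + p') \<or> (\<exists>p\<in>PA. q = p + (0, 1))"
proof -
  obtain x c where xc: "q = (x, c)" by force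
  have x: "x \<in> \<Delta>" "c \<in> \<int>" "c > 0 \<or> c = 0 \<and> x \<in> P" using q(1) by (auto simp: xc PA_iff)
  consider (zero) "c = 0" "x \<in> P" | (imag) "c \<ge> 1" "c \<ge> 2 \<or> x \<in> P" | (one) "c = 1" "- x \<in> P"
  proof -
    obtain k :: int where k: "c = of_int k" using x(2) by (auto elim!: Ints_cases)
    then have "k = 0 \<and> x \<in> P \<or> k = 1 \<or> k \<ge> 2" using x(3) by auto
    then show ?thesis using k neg_pos_iff[OF x(1)] that by fastforce
  qed
  then show ?thesis
  proof cases
    case zero
    then have "x \<notin> B" using q(2) by (auto simp: xc affine_simple_def)
    then obtain b where b: "b \<in> B" "x \<cdot> b = 1" using nonsimple_descent zero by blast
    have "(x - b, 0) \<in> PA" "(b, 0) \<in> PA"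
      using simple_diff_pos zero b base_pos by (auto simp: PA_iff pos_root)
    moreover have "q = (x - b, 0) + (b, 0)" using zero by (simp add: xc)
    ultimately show ?thesis by blast
  next
    case imag
    then have "(x, c - 1) \<in> PA" using x by (auto simp: PA_iff)
    moreover have "q = (x, c - 1) + (0, 1)" by (simp add: xc)
    ultimately show ?thesis by blast
  next
    case one
    let ?y = "- x"
    have "x \<noteq> - highest_root \<Delta> B" using q(2) one by (auto simp: xc affine_simple_def alpha0)
    then have y: "?y \<in> \<Delta>" "?y \<noteq> highest_root \<Delta> B" using x(1) by (simp, metis minus_minus)
    have "\<exists>b\<in>B. ?y \<cdot> b < 0"
    proof (rule ccontr)
      assume n: "\<not> ?thesis"
      obtain w where "w \<in> W" "w ?y = highest_root \<Delta> B" using weyl_transitive y(1) highest_root(1) by blast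
      then have "?y = highest_root \<Delta> B"
        using dominant_weyl_unique[of w ?y] n highest_root_dominant by (metis not_less)
      then show False using y by simp
    qed
    then obtain b where b: "b \<in> B" "?y \<cdot> b < 0" by blast
    have "?y \<noteq> - b" using one base_pos[OF b(1)] neg_pos_iff[OF base_root[OF b(1)]] by auto
    then have "x \<cdot> b = 1" using pairing_cases[OF y(1) base_root[OF b(1)]] b(2) by auto
    then have "(x - b, 1) \<in> PA" "(b, 0) \<in> PA"
      using x(1) b(1) by (auto simp: PA_iff root_diff base_root base_pos)
    moreover have "q = (x - b, 1) + (b, 0)" using one by (simp add: xc)
    ultimately show ?thesis by blast
  qed
qed


section \<open>Abelian ideals as affine inversion sets\<close>

text \<open>The affine roots \<delta> - \<gamma> for \<gamma> in I.\<close>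

definition shift :: "'a set \<Rightarrow> ('a \<times> real) set" where
  "shift I = (\<lambda>\<gamma>. (- \<gamma>, 1)) ` I"

lemma shift_eq: "{basic_imaginary_root - (\<gamma>, 0) | \<gamma>. \<gamma> \<in> I} = shift I"
  by (auto simp: shift_def basic_imaginary_root_def)

lemma shift_iff [simp]: "(- \<gamma>, 1) \<in> shift I \<longleftrightarrow> \<gamma> \<in> I"
  by (auto simp: shift_def)

lemma abelian_ideal_pos: "abelian_ideal \<Delta> B I \<Longrightarrow> \<gamma> \<in> I \<Longrightarrow> \<gamma> \<in> P"
  and abelian_ideal_up: "abelian_ideal \<Delta> B I \<Longrightarrow> \<gamma> \<in> I \<Longrightarrow> \<nu> \<in> P \<Longrightarrow> \<gamma> + \<nu> \<in> \<Delta> \<Longrightarrow> \<gamma> + \<nu> \<in> I"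
  and abelian_ideal_sum: "abelian_ideal \<Delta> B I \<Longrightarrow> \<gamma> \<in> I \<Longrightarrow> \<gamma>' \<in> I \<Longrightarrow> \<gamma> + \<gamma>' \<notin> \<Delta>"
  by (auto simp: abelian_ideal_def)

text \<open>The ideal is built up one root at a time. A root \<gamma> of minimal height can be
  removed from I to leave an abelian ideal J with element w. Then w sends \<delta> - \<gamma> to a
  simple affine root z, and the reflection in z adds this one inversion. If z were a sum of two
  positive affine roots, pulling the sum back by w would write \<delta> - \<gamma> as a sum; its
  summands would contradict that I is closed under adding positive roots, or that it is
  abelian.\<close>

lemma ex_ideal_element:
  assumes "abelian_ideal \<Delta> B I" shows "\<exists>w\<in>affine_weyl_group \<Delta> B. inv_set w = shift I"
  using assms
proof (induction "card I" arbitrary: I)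
  case 0
  have "finite I" using abelian_ideal_pos[OF 0(2)] pos_root finite_roots by (meson finite_subset subsetI)
  then have "I = {}" using 0 by simp
  moreover have "inv_set id = {}"
    using neg_PA_iff[OF PA_affine_roots] by (auto simp: affine_inversions_def)
  ultimately show ?case using affine_id by (auto simp: shift_def)
next
  case (Suc n)
  note I = Suc.prems
  have fin: "finite I" using Suc.hyps(2) by (metis card.infinite nat.distinct(1))
  have "I \<noteq> {}" using Suc.hyps(2) by auto
  then obtain \<gamma> where g: "\<gamma> \<in> I" "\<And>x. x \<in> I \<Longrightarrow> height \<gamma> \<le> height x"
  proof -
    have "Min (height ` I) \<in> height ` I" "\<And>x. x \<in> I \<Longrightarrow> Min (height ` I) \<le> height x"
      using fin \<open>I \<noteq> {}\<close> by auto
    then show ?thesis using that by (metis imageE)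
  qed
  define J where "J = I - {\<gamma>}"
  have JI: "J \<subseteq> I" by (auto simp: J_def)
  have J: "abelian_ideal \<Delta> B J" unfolding abelian_ideal_def
  proof (intro conjI ballI impI)
    show "J \<subseteq> P" using JI abelian_ideal_pos[OF I] by blast
  next
    fix x \<nu> assume x: "x \<in> J" "\<nu> \<in> P" "x + \<nu> \<in> \<Delta>"
    have "height x < height (x + \<nu>)" using pos_height[OF x(2)] by simp
    then have "x + \<nu> \<noteq> \<gamma>" using g(2)[of x] x(1) JI by force
    then show "x + \<nu> \<in> J" using abelian_ideal_up[OF I _ x(2,3)] x(1) by (auto simp: J_def)
  next
    fix x y assume "x \<in> J" "y \<in> J"
    then show "x + y \<notin> \<Delta>" using abelian_ideal_sum[OF I] JI by blast
  qed
  have "n = card J" using Suc.hyps(2) g(1) fin by (simp add: J_def)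
  from Suc.hyps(1)[OF this J] obtain w
    where wW: "w \<in> affine_weyl_group \<Delta> B" and inv: "inv_set w = shift J" by blast
  note w = affine_weyl_affine_maps[OF wW]
  obtain v where v: "v \<in> affine_maps" "\<And>q. v (w q) = q" "\<And>q. w (v q) = q"
    using affine_maps_inverseE[OF w] by blast
  have gP: "\<gamma> \<in> P" and g\<Delta>: "\<gamma> \<in> \<Delta>" using abelian_ideal_pos[OF I g(1)] pos_root by auto
  define z where "z = w (- \<gamma>, 1)"
  have r: "(- \<gamma>, 1) \<in> PA" using g\<Delta> by (simp add: PA_iff)
  have "(- \<gamma>, 1) \<notin> inv_set w" unfolding inv by (simp add: J_def)
  then have "- z \<notin> PA" using r by (simp add: affine_inversions_def z_def)
  then have zP: "z \<in> PA"
    using neg_PA_iff[OF affine_maps_roots[OF w PA_affine_roots[OF r]]] z_def by simp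
  have vz: "v z = (- \<gamma>, 1)" by (simp add: z_def v(2))
  \<comment> \<open>Pulled back by w, a positive root is positive or of the form \<gamma>' -
    \<delta> with \<gamma>' in J.\<close>
  have pull: "v p \<in> PA \<or> (\<exists>\<gamma>'\<in>J. v p = (\<gamma>', -1))" if p: "p \<in> PA" for p
  proof (cases "v p \<in> PA")
    case False
    then have "- v p \<in> PA" using neg_PA_iff affine_maps_roots[OF v(1) PA_affine_roots[OF p]] by blast
    moreover have "w (- v p) = - p" using v(3) by (simp add: affine_maps_simps[OF w])
    ultimately have "- v p \<in> shift J" using p unfolding inv[symmetric] by (simp add: affine_inversions_def)
    then obtain \<gamma>' where "\<gamma>' \<in> J" "- v p = (- \<gamma>', 1)" by (auto simp: shift_def)
    then have "v p = (\<gamma>', -1)" by (cases "v p") auto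
    then show ?thesis using \<open>\<gamma>' \<in> J\<close> by blast
  qed simp
  have "z \<in> affine_simple"
  proof (rule ccontr)
    \<comment> \<open>The levels of the two summands add up to 1, so one of them is at most
      0.\<close>
    have real_part: False if p: "p \<in> PA" "p' \<in> PA" "z = p + p'" and le: "snd (v p) \<le> 0" for p p'
    proof -
      have sum: "v p + v p' = (- \<gamma>, 1)" using p(3) vz affine_maps_simps[OF v(1)] by metis
      from pull[OF p(1)] show False
      proof
        assume "v p \<in> PA"
        with le obtain a where a: "v p = (a, 0)" "a \<in> P" by (cases "v p") (auto simp: PA_iff)
        have vp': "v p' = (- (\<gamma> + a), 1)" using sum a by (cases "v p'") (auto simp: algebra_simps)
        have "v p' \<in> affine_roots" using affine_maps_roots[OF v(1) PA_affine_roots[OF p(2)]] .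
        then have "\<gamma> + a \<in> \<Delta>" unfolding vp' using uminus_root_iff[of "\<gamma> + a"] by simp
        then have "\<gamma> + a \<in> I" using abelian_ideal_up[OF I g(1) a(2)] by simp
        moreover have "a \<noteq> 0" using a(2) pos_root root_nonzero by blast
        ultimately have "v p' \<in> inv_set w" unfolding inv vp' shift_iff by (simp add: J_def)
        then have "- p' \<in> PA" by (simp add: affine_inversions_def v(3))
        then show False using neg_PA_iff[OF PA_affine_roots] p(2) by blast
      next
        assume "\<exists>\<gamma>'\<in>J. v p = (\<gamma>', - 1)"
        then obtain \<gamma>' where g': "\<gamma>' \<in> J" "v p = (\<gamma>', -1)" by blast
        have vp': "v p' = (- (\<gamma> + \<gamma>'), 2)" 
        proof -
          have "v p' = (- \<gamma>, 1) - v p" using sum by (metis add_diff_cancel_left')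
          then show ?thesis by (simp add: g'(2))
        qed
        have "v p' \<in> affine_roots" using affine_maps_roots[OF v(1) PA_affine_roots[OF p(2)]] .
        then have "\<gamma> + \<gamma>' \<in> \<Delta>" unfolding vp' using uminus_root_iff[of "\<gamma> + \<gamma>'"] by simp
        then show False using abelian_ideal_sum[OF I g(1)] g'(1) JI by blast
      qed
    qed
    assume "z \<notin> affine_simple"
    from affine_nonsimple_decomp[OF zP this] show False
    proof
      assume "\<exists>p\<in>PA. \<exists>p'\<in>PA. z = p + p'"
      then obtain p p' where p: "p \<in> PA" "p' \<in> PA" "z = p + p'" by blast
      have "v p + v p' = (- \<gamma>, 1)" using p(3) vz affine_maps_simps[OF v(1)] by metis
      then have "snd (v p) + snd (v p') = 1" by (metis snd_add snd_conv)
      moreover have "snd (v p) \<in> \<int>" "snd (v p') \<in> \<int>"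
        using affine_maps_roots[OF v(1) PA_affine_roots[OF p(1)]]
          affine_maps_roots[OF v(1) PA_affine_roots[OF p(2)]]
        by (auto simp: affine_roots_def)
      ultimately have "snd (v p) \<le> 0 \<or> snd (v p') \<le> 0" by (auto elim!: Ints_cases)
      then show False using real_part[OF p] real_part[of p' p] p by (auto simp: add.commute)
    next
      assume "\<exists>p\<in>PA. z = p + (0, 1)"
      then obtain p where p: "p \<in> PA" "z = p + (0, 1)" by blast
      then have "v p + (0, 1) = (- \<gamma>, 1)" using vz affine_maps_simps[OF v(1)] by metis
      then have "v p = (- \<gamma>, 0)" by (cases "v p") auto
      then show False using pull[OF p(1)] gP neg_pos_iff[OF g\<Delta>] by (auto simp: PA_iff)
    qed
  qed
  from affine_inversions_step[OF w this r] affine_reflection_simple(3)[OF this wW]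
  have "affine_reflection z \<circ> w \<in> affine_weyl_group \<Delta> B"
    "inv_set (affine_reflection z \<circ> w) = insert (- \<gamma>, 1) (shift J)" by (auto simp: z_def inv)
  moreover have "insert (- \<gamma>, 1) (shift J) = shift I" using g(1) by (auto simp: shift_def J_def)
  ultimately show ?case by metis
qed

lemma ideal_element_eq:
  assumes "w \<in> affine_weyl_group \<Delta> B" "inv_set w = shift I" shows "ideal_element \<Delta> B I = w"
  unfolding ideal_element_def shift_eq
  by (rule the_equality) (use assms affine_maps_eqI affine_weyl_affine_maps in auto)

lemma ideal_element:
  assumes "abelian_ideal \<Delta> B I"
  shows "ideal_element \<Delta> B I \<in> affine_weyl_group \<Delta> B" "inv_set (ideal_element \<Delta> B I) = shift I"
  using ex_ideal_element[OF assms] ideal_element_eq by auto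


end

text \<open>Here a is the simple root whose fundamental weight is \<theta>. The degree of a root is
  its pairing with \<theta>.\<close>

locale heisenberg_grading = laced_root_system +
  fixes \<theta> a :: 'a
  assumes theta: "\<theta> = highest_root \<Delta> B"
    and a_base: "a \<in> B"
    and theta_a: "\<theta> \<cdot> a = 1"
    and theta_base: "b \<in> B \<Longrightarrow> b \<noteq> a \<Longrightarrow> \<theta> \<cdot> b = 0"
begin

section \<open>The grading by the highest root\<close>

definition degree_one :: "'a set" where "degree_one = {\<gamma> \<in> \<Delta>. \<gamma> \<cdot> \<theta> = 1}"
definition pos_degree_zero :: "'a set" where "pos_degree_zero = {\<gamma> \<in> P. \<gamma> \<cdot> \<theta> = 0}"

lemma theta_root: "\<theta> \<in> \<Delta>" and theta_pos: "\<theta> \<in> P" and theta_self: "\<theta> \<cdot> \<theta> = 2"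
  using highest_root(1) highest_root_pos by (auto simp: theta pairing_self)

lemma a_root: "a \<in> \<Delta>" and a_pos: "a \<in> P" and a_self: "a \<cdot> a = 2" and a_theta: "a \<cdot> \<theta> = 1"
  using a_base base_root base_pos theta_a by (auto simp: pairing_self pairing_commute)

lemma theta_above: "\<gamma> \<in> \<Delta> \<Longrightarrow> \<theta> - \<gamma> \<in> nn"
  using highest_root(2) by (simp add: theta)

lemma degree_one_root: "\<gamma> \<in> degree_one \<Longrightarrow> \<gamma> \<in> \<Delta>" and degree_one_grade: "\<gamma> \<in> degree_one \<Longrightarrow> \<gamma> \<cdot> \<theta> = 1" "\<gamma> \<in> degree_one \<Longrightarrow> \<theta> \<cdot> \<gamma> = 1"
  and degree_oneI: "\<gamma> \<in> \<Delta> \<Longrightarrow> \<gamma> \<cdot> \<theta> = 1 \<Longrightarrow> \<gamma> \<in> degree_one"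
  by (auto simp: degree_one_def pairing_commute)

lemma a_degree_one: "a \<in> degree_one" using a_root a_theta by (rule degree_oneI)

lemma nn_grade_nonneg: "x \<in> nn \<Longrightarrow> x \<cdot> \<theta> \<ge> 0"
  using highest_root_pairing_nonneg by (simp add: theta pairing_commute)

text \<open>The degree of a nonnegative combination is its coefficient at a.\<close>

lemma nn_minus_grade:
  assumes "x \<in> nn" shows "x - (x \<cdot> \<theta>) *\<^sub>R a \<in> nn"
proof -
  obtain c :: "'a \<Rightarrow> nat" where x: "x = (\<Sum>b\<in>B. real (c b) *\<^sub>R b)"
    using assms unfolding nonneg_combs_def by auto
  have split: "(\<Sum>b\<in>B. f b) = f a + (\<Sum>b\<in>B - {a}. f b)" for f :: "'a \<Rightarrow> 'c::comm_monoid_add"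
    using sum.remove[OF finite_base a_base] by blast
  have "\<theta> \<cdot> x = (\<Sum>b\<in>B. real (c b) * (\<theta> \<cdot> b))" by (simp add: x pairing_sum)
  also have "\<dots> = real (c a) + (\<Sum>b\<in>B - {a}. real (c b) * (\<theta> \<cdot> b))"
    by (simp add: split theta_a)
  also have "(\<Sum>b\<in>B - {a}. real (c b) * (\<theta> \<cdot> b)) = 0"
    by (rule sum.neutral) (simp add: theta_base)
  finally have xt: "x \<cdot> \<theta> = real (c a)" by (simp add: pairing_commute)
  have "x - (x \<cdot> \<theta>) *\<^sub>R a = (\<Sum>b\<in>B - {a}. real (c b) *\<^sub>R b)"
    unfolding xt by (simp add: x split)
  also have "\<dots> = (\<Sum>b\<in>B. real ((c(a := 0)) b) *\<^sub>R b)"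
  proof -
    have "(\<Sum>b\<in>B - {a}. real (c b) *\<^sub>R b) = (\<Sum>b\<in>B - {a}. real ((c(a := 0)) b) *\<^sub>R b)"
      by (rule sum.cong) auto
    then show ?thesis unfolding split[of "\<lambda>b. real ((c(a := 0)) b) *\<^sub>R b"]
      by (simp only: fun_upd_same of_nat_0 scaleR_zero_left add_0_left)
  qed
  finally show ?thesis unfolding nonneg_combs_def by (intro CollectI exI)
qed

text \<open>A large multiple of \<theta> is subtracted from y to rule out the simple root a; this
  does not change the pairings with vectors of degree zero.\<close>

lemma nn_grade0_pairing_pos:
  assumes "x \<in> nn" "x \<cdot> \<theta> = 0" "y \<cdot> x > 0" shows "\<exists>b\<in>B. b \<noteq> a \<and> y \<cdot> b > 0"
proof -
  let ?y = "y - (\<bar>y \<cdot> a\<bar>) *\<^sub>R \<theta>"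
  have "?y \<cdot> x > 0" using assms by (simp add: pairing_commute[of \<theta>])
  from nn_pairing_pos[OF assms(1) this] obtain b where b: "b \<in> B" "?y \<cdot> b > 0" by blast
  have "b \<noteq> a" using b(2) by (auto simp: theta_a)
  then show ?thesis using b theta_base by auto
qed

lemma grade_pos: assumes "\<gamma> \<in> \<Delta>" "\<gamma> \<cdot> \<theta> > 0" shows "\<gamma> \<in> P"
  using nn_grade_nonneg[OF pos_nn, of "- \<gamma>"] neg_pos_iff[OF assms(1)] assms(2) by fastforce

lemma pos_grade_cases:
  assumes "p \<in> P"
  obtains (zero) "p \<in> pos_degree_zero" | (one) "p \<in> degree_one" | (two) "p = \<theta>"
  using pairing_cases[OF pos_root[OF assms] theta_root] nn_grade_nonneg[OF pos_nn[OF assms]] assms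
    pos_root[OF assms] by (auto simp: pos_degree_zero_def degree_one_def)

lemma degree_one_pos: "\<gamma> \<in> degree_one \<Longrightarrow> \<gamma> \<in> P"
  using grade_pos by (simp add: degree_one_def)

lemma degree_one_minus_a: "\<gamma> \<in> degree_one \<Longrightarrow> \<gamma> - a \<in> nn"
  using nn_minus_grade[OF pos_nn[OF degree_one_pos]] by (simp add: degree_one_grade)

lemma degree_one_partner: "\<gamma> \<in> degree_one \<Longrightarrow> \<theta> - \<gamma> \<in> degree_one"
  using root_diff[OF theta_root, of \<gamma>] by (intro degree_oneI) (auto simp: degree_one_grade degree_one_root theta_self)

lemma pos_degree_zero_root: "\<nu> \<in> pos_degree_zero \<Longrightarrow> \<nu> \<in> \<Delta>" and pos_degree_zero_pos: "\<nu> \<in> pos_degree_zero \<Longrightarrow> \<nu> \<in> P"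
  and pos_degree_zero_grade: "\<nu> \<in> pos_degree_zero \<Longrightarrow> \<nu> \<cdot> \<theta> = 0" "\<nu> \<in> pos_degree_zero \<Longrightarrow> \<theta> \<cdot> \<nu> = 0"
  by (auto simp: pos_degree_zero_def pos_root pairing_commute)

lemma pos_degree_zero_pairing_a: assumes "\<nu> \<in> pos_degree_zero" shows "\<nu> \<cdot> a = 0 \<or> \<nu> \<cdot> a = -1"
proof -
  note g = pos_degree_zero_grade(1)[OF assms]
  have "\<nu> \<cdot> a \<noteq> 1"
  proof
    assume "\<nu> \<cdot> a = 1"
    then have "(\<nu> - a) \<cdot> \<theta> \<ge> 0"
      using nn_grade_nonneg[OF pos_nn] simple_diff_pos pos_degree_zero_pos[OF assms] a_base by blast
    then show False by (simp add: g a_theta)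
  qed
  moreover have "\<nu> \<noteq> a" "\<nu> \<noteq> - a" using g a_theta by auto
  ultimately show ?thesis using pairing_cases[OF pos_degree_zero_root[OF assms] a_root] by auto
qed

text \<open>The degree one part has a as its only lowest element: every other element can be lowered
  by a simple root of degree zero. This is where it matters that \<theta> is a fundamental weight,
  since otherwise the degree one part would have several lowest elements.\<close>

lemma degree_one_descent:
  assumes "\<gamma> \<in> degree_one" "\<gamma> \<noteq> a"
  shows "\<exists>b\<in>B. b \<noteq> a \<and> \<gamma> \<cdot> b = 1 \<and> \<gamma> - b \<in> degree_one"
proof -
  have "\<gamma> \<cdot> a \<le> 1" using pairing_cases[OF degree_one_root[OF assms(1)] a_root] assms(2) by auto
  then have "\<gamma> \<cdot> (\<gamma> - a) > 0" using pairing_self[OF degree_one_root[OF assms(1)]] by simp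
  moreover have "(\<gamma> - a) \<cdot> \<theta> = 0" by (simp add: degree_one_grade assms(1) a_theta)
  ultimately obtain b where b: "b \<in> B" "b \<noteq> a" "\<gamma> \<cdot> b > 0"
    using nn_grade0_pairing_pos degree_one_minus_a[OF assms(1)] by blast
  have bt: "b \<cdot> \<theta> = 0" using theta_base[OF b(1,2)] by (simp add: pairing_commute)
  then have "\<gamma> \<noteq> b" using degree_one_grade(1)[OF assms(1)] by auto
  then have one: "\<gamma> \<cdot> b = 1"
    using pairing_cases[OF degree_one_root[OF assms(1)] base_root[OF b(1)]] b(3) by auto
  moreover have "\<gamma> - b \<in> degree_one"
    using root_diff[OF degree_one_root[OF assms(1)] base_root[OF b(1)] one]
    by (rule degree_oneI) (simp add: degree_one_grade assms(1) bt)
  ultimately show ?thesis using b by blast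
qed

lemma degree_one_induct [consumes 1, case_names base step]:
  assumes "\<gamma> \<in> degree_one" "Q a"
    and step: "\<And>\<gamma> b. \<gamma> \<in> degree_one \<Longrightarrow> b \<in> B \<Longrightarrow> b \<noteq> a \<Longrightarrow> \<gamma> \<cdot> b = 1 \<Longrightarrow> \<gamma> - b \<in> degree_one \<Longrightarrow> Q (\<gamma> - b) \<Longrightarrow> Q \<gamma>"
  shows "Q \<gamma>"
proof -
  have "\<gamma> \<in> nn \<Longrightarrow> \<gamma> \<in> degree_one \<longrightarrow> Q \<gamma>"
  proof (induction rule: height_induct)
    case (less \<gamma>)
    show ?case
    proof
      assume g: "\<gamma> \<in> degree_one"
      show "Q \<gamma>"
      proof (cases "\<gamma> = a")
        case True
        then show ?thesis using assms(2) by simp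
      next
        case False
        then obtain b where b: "b \<in> B" "b \<noteq> a" "\<gamma> \<cdot> b = 1" "\<gamma> - b \<in> degree_one" using degree_one_descent g by blast
        have "height (\<gamma> - b) + 1 \<le> height \<gamma>" by (simp add: height_base b)
        then have "Q (\<gamma> - b)" using less(2)[OF pos_nn[OF degree_one_pos[OF b(4)]]] b(4) by blast
        then show ?thesis using step[OF g b] by blast
      qed
    qed
  qed
  then show ?thesis using assms(1) pos_nn[OF degree_one_pos] by blast
qed

section \<open>The candidate ideal\<close>

text \<open>Of two roots of degree one with sum \<theta>, the pairings with a add up to 1, so
  exactly one of the two belongs to this set.\<close>

definition heisenberg_ideal :: "'a set" where "heisenberg_ideal = insert \<theta> {\<gamma> \<in> degree_one. \<gamma> \<cdot> a \<le> 0}"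

lemma grade_two: "\<gamma> \<in> \<Delta> \<Longrightarrow> \<gamma> \<cdot> \<theta> \<ge> 2 \<Longrightarrow> \<gamma> = \<theta> \<and> \<gamma> \<cdot> \<theta> = 2"
  using pairing_cases[OF _ theta_root, of \<gamma>] by auto

lemma heisenberg_ideal_abelian: "abelian_ideal \<Delta> B heisenberg_ideal"
  unfolding abelian_ideal_def
proof (intro conjI ballI impI)
  show "heisenberg_ideal \<subseteq> P" using theta_pos degree_one_pos by (auto simp: heisenberg_ideal_def)
next
  fix \<gamma> \<nu> assume *: "\<gamma> \<in> heisenberg_ideal" "\<nu> \<in> P" "\<gamma> + \<nu> \<in> \<Delta>"
  note n = nn_grade_nonneg[OF pos_nn[OF *(2)]]
  show "\<gamma> + \<nu> \<in> heisenberg_ideal"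
  proof (cases "\<gamma> = \<theta>")
    case True
    then have "\<theta> + \<nu> = \<theta>" using grade_two[OF *(3)] n theta_self by simp
    then show ?thesis using True by (simp add: heisenberg_ideal_def)
  next
    case False
    then have g: "\<gamma> \<in> degree_one" "\<gamma> \<cdot> a \<le> 0" using *(1) by (auto simp: heisenberg_ideal_def)
    from *(2) show ?thesis
    proof (cases rule: pos_grade_cases)
      case zero
      then have "\<gamma> + \<nu> \<in> degree_one" using *(3) g(1) by (intro degree_oneI) (simp_all add: degree_one_grade pos_degree_zero_grade)
      then show ?thesis using g(2) pos_degree_zero_pairing_a[OF zero] by (auto simp: heisenberg_ideal_def)
    next
      case one
      then show ?thesis using grade_two[OF *(3)] g(1) by (simp add: degree_one_grade heisenberg_ideal_def)
    next
      case two
      then show ?thesis using grade_two[OF *(3)] g(1) by (simp add: degree_one_grade theta_self)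
    qed
  qed
next
  fix \<gamma> \<gamma>' assume *: "\<gamma> \<in> heisenberg_ideal" "\<gamma>' \<in> heisenberg_ideal"
  show "\<gamma> + \<gamma>' \<notin> \<Delta>"
  proof
    assume r: "\<gamma> + \<gamma>' \<in> \<Delta>"
    have "\<gamma> \<cdot> \<theta> \<ge> 1" "\<gamma>' \<cdot> \<theta> \<ge> 1" using * by (auto simp: heisenberg_ideal_def degree_one_grade theta_self)
    then have "\<gamma> + \<gamma>' = \<theta>" "\<gamma> \<noteq> \<theta>" "\<gamma>' \<noteq> \<theta>"
      using grade_two[OF r] theta_self by auto
    moreover from this have "\<gamma> \<cdot> a \<le> 0" "\<gamma>' \<cdot> a \<le> 0" using * by (auto simp: heisenberg_ideal_def)
    ultimately show False using theta_a pairing_simps(1)[of \<gamma> \<gamma>' a] by simp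
  qed
qed

text \<open>The degree of m \<gamma> is 1 - (\<gamma>, a), as \<theta> is the image of \<theta> - a.
  A positive degree makes m \<gamma> positive. If (\<gamma>, a) = 1, the partner \<theta> - \<gamma>
  is sent to a root of degree one, which lies above a, and m \<gamma> is a minus that root.\<close>

lemma degree_one_sign:
  assumes m: "m \<in> W" "m \<theta> = a" "m a = a - \<theta>" and g: "\<gamma> \<in> degree_one"
  shows "m \<gamma> \<in> P \<longleftrightarrow> \<gamma> \<cdot> a \<le> 0"
proof -
  have "m (\<theta> - a) = \<theta>" using m by (simp add: weyl_simps)
  then have grade: "m x \<cdot> \<theta> = x \<cdot> (\<theta> - a)" for x using weyl_isometry[OF m(1), of x "\<theta> - a"] by simp
  show ?thesis
  proof (cases "\<gamma> \<cdot> a \<le> 0")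
    case True
    then have "m \<gamma> \<cdot> \<theta> > 0" using grade[of \<gamma>] degree_one_grade[OF g] by simp
    then show ?thesis using True grade_pos weyl_root[OF m(1) degree_one_root[OF g]] by simp
  next
    case False
    note r = weyl_root[OF m(1) degree_one_root[OF g]]
    consider "\<gamma> = a" | "\<gamma> \<cdot> a = 1" using pairing_cases[OF degree_one_root[OF g] a_root] False by auto
    then have "- m \<gamma> \<in> nn"
    proof cases
      case 1
      then show ?thesis using m(3) theta_above[OF a_root] by simp
    next
      case 2
      note p = degree_one_partner[OF g]
      have "m (\<theta> - \<gamma>) \<in> degree_one" using weyl_root[OF m(1) degree_one_root[OF p]]
        by (rule degree_oneI) (use grade[of "\<theta> - \<gamma>"] 2 g in \<open>simp add: degree_one_grade theta_self theta_a\<close>)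
      from degree_one_minus_a[OF this] show ?thesis using m by (simp add: weyl_simps)
    qed
    then have "- m \<gamma> \<in> P" using r posI by simp
    then show ?thesis using False neg_pos_iff[OF r] by simp
  qed
qed

text \<open>A reduced m from \<theta> to a is increasing along simple roots of degree zero, so a,
  the lowest root of degree one, goes to the lowest root pairing to 1 with a, which is a -
  \<theta>.\<close>

lemma min_element_theta:
  defines "m \<equiv> min_element \<Delta> B \<theta> a"
  shows "m \<in> W" "m \<theta> = a" "reduced m \<theta>" "m a = a - \<theta>"
proof -
  show m: "m \<in> W" "m \<theta> = a" "reduced m \<theta>"
    using min_element[OF theta_root a_root] by (simp_all add: m_def)
  obtain v where v: "v \<in> W" "\<And>x. v (m x) = x" "\<And>x. m (v x) = x" using weyl_inverseE[OF m(1)] by blast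
  define y where "y = v (a - \<theta>)"
  have my: "m y = a - \<theta>" by (simp add: y_def v)
  have "a - \<theta> \<in> \<Delta>" using root_diff[OF a_root theta_root a_theta] .
  then have "y \<in> \<Delta>" using weyl_root v(1) y_def by blast
  moreover have "y \<cdot> \<theta> = 1" using weyl_isometry[OF m(1), of y \<theta>] my m(2) by (simp add: a_self theta_a)
  ultimately have y: "y \<in> degree_one" by (rule degree_oneI)
  have "y = a"
  proof (rule ccontr)
    assume "y \<noteq> a"
    then obtain b where b: "b \<in> B" "b \<noteq> a" "y - b \<in> degree_one" using degree_one_descent[OF y] by blast
    have p: "m b \<in> P" using reducedD[OF m(3) base_pos[OF b(1)]] theta_base[OF b(1,2)]
      by (simp add: pairing_commute)
    have eq: "m (y - b) = a - \<theta> - m b" using my by (simp add: weyl_simps m(1))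
    have "m (y - b) \<in> \<Delta>" using weyl_root[OF m(1) degree_one_root[OF b(3)]] .
    then have "\<theta> - (- m (y - b)) \<in> nn" by (intro theta_above) simp
    then have le: "a - m b \<in> nn" by (simp add: eq)
    then have "m b = a"
      using nn_height[OF le] pos_height[OF p] height_base[OF a_base] by fastforce
    then have "m (y - b) = - \<theta>" by (simp add: eq)
    then show False
      using weyl_isometry[OF m(1), of "y - b" \<theta>] degree_one_grade[OF b(3)] m(2) theta_a by simp
  qed
  then show "m a = a - \<theta>" using my by simp
qed

section \<open>The fibre of the simple root\<close>

text \<open>The element of the ideal is the affine reflection in \<alpha>_0 followed by the reduced
  element from \<theta> to a; its inversions are found degree by degree.\<close>

lemma heisenberg_ideal_fibre: "heisenberg_ideal \<in> tau_fibre \<Delta> B a"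
proof -
  define m where "m = min_element \<Delta> B \<theta> a"
  note m = min_element_theta[folded m_def]
  define w where "w = affine_map m 0 \<circ> affine_reflection (alpha0 \<Delta> B)"
  have w: "w (x, c) = (m (x - (x \<cdot> \<theta>) *\<^sub>R \<theta>), c + x \<cdot> \<theta>)" for x c
    unfolding w_def affine_reflection_alpha0 theta[symmetric]
    by (simp add: reflection_pairing theta_root)
  have "affine_reflection (alpha0 \<Delta> B) \<in> affine_weyl_group \<Delta> B"
    using affine_zero_step[OF affine_id] by simp
  then have wW: "w \<in> affine_weyl_group \<Delta> B" unfolding w_def by (rule weyl_affine_weyl[OF m(1)])
  have inv: "- w (x, c) \<in> PA \<longleftrightarrow> c = 1 \<and> - x \<in> heisenberg_ideal" if q: "(x, c) \<in> PA" for x c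
  proof -
    have x: "x \<in> \<Delta>" "c \<in> \<int>" "c > 0 \<or> c = 0 \<and> x \<in> P" using q by (auto simp: PA_iff)
    then obtain k :: int where k: "c = of_int k" by (auto elim!: Ints_cases)
    have neg0: "c \<ge> 1" if "x \<notin> P" using x(3) that k by auto
    have sq: "m x' \<in> \<Delta>" if "x' \<in> \<Delta>" for x' using weyl_root[OF m(1) that] .
    consider (tt) "x = - \<theta>" | (t) "x = \<theta>" | (mone) "- x \<in> degree_one" | (zero) "x \<cdot> \<theta> = 0" | (one) "x \<in> degree_one"
      using pairing_cases[OF x(1) theta_root] x(1) by (auto simp: degree_one_def)
    then show ?thesis
    proof cases
      case tt
      then have "x \<notin> P" using theta_pos neg_pos_iff[OF theta_root] by simp
      then have "c \<ge> 1" by (rule neg0)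
      have "w (x, c) = (a, c - 2)" unfolding w tt by (simp add: theta_self scaleR_2 m)
      then show ?thesis using \<open>c \<ge> 1\<close> k a_pos a_root neg_pos_iff[OF a_root]
        by (auto simp: PA_iff tt heisenberg_ideal_def)
    next
      case t
      have "w (x, c) = (- a, c + 2)" unfolding w t by (simp add: theta_self scaleR_2 m weyl_simps)
      moreover have "- \<theta> \<notin> heisenberg_ideal"
        using abelian_ideal_pos[OF heisenberg_ideal_abelian, of "- \<theta>"] neg_pos_iff[OF theta_root] theta_pos by blast
      ultimately show ?thesis using x(3) by (auto simp: PA_iff t)
    next
      case mone
      have "x \<notin> P" using degree_one_pos[OF mone] neg_pos_iff[OF x(1)] by simp
      then have "c \<ge> 1" by (rule neg0)
      have g: "x \<cdot> \<theta> = -1" using degree_one_grade(1)[OF mone] by simp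
      define p where "p = \<theta> + x"
      have p: "p \<in> degree_one" using degree_one_partner[OF mone] by (simp add: p_def)
      have eq: "w (x, c) = (m p, c - 1)" unfolding w g p_def by (simp add: add.commute)
      have "- w (x, c) \<in> PA \<longleftrightarrow> c = 1 \<and> m p \<notin> P"
        unfolding eq using sq[OF degree_one_root[OF p]] \<open>c \<ge> 1\<close> k neg_pos_iff[OF sq[OF degree_one_root[OF p]]]
        by (auto simp: PA_iff)
      also have "m p \<notin> P \<longleftrightarrow> \<not> p \<cdot> a \<le> 0" using degree_one_sign[OF m(1,2,4) p] by simp
      also have "\<dots> \<longleftrightarrow> (- x) \<cdot> a \<le> 0"
      proof -
        have "x \<cdot> a \<in> \<int>" using pairing_Ints[OF x(1) a_root] .
        then show ?thesis by (auto simp: p_def theta_a elim!: Ints_cases)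
      qed
      also have "\<dots> \<longleftrightarrow> - x \<in> heisenberg_ideal"
        using mone degree_one_grade(1)[OF mone] theta_self by (auto simp: heisenberg_ideal_def)
      finally show ?thesis .
    next
      case zero
      have "w (x, c) = (m x, c)" unfolding w by (simp add: zero)
      moreover have "m x \<in> P" if "c = 0"
        using reducedD[OF m(3)] x(3) zero that by auto
      moreover have "- x \<notin> heisenberg_ideal"
      proof -
        have "(- x) \<cdot> \<theta> = 0" using zero by simp
        then show ?thesis using theta_self degree_one_grade(1)[of "- x"] by (auto simp: heisenberg_ideal_def simp del: pairing_simps)
      qed
      ultimately show ?thesis using x(3) sq[OF x(1)] neg_pos_iff[OF sq[OF x(1)]] by (auto simp: PA_iff)
    next
      case one
      have "snd (w (x, c)) = c + 1" unfolding w by (simp add: degree_one_grade one)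
      moreover have "- x \<notin> heisenberg_ideal"
      proof -
        have "(- x) \<cdot> \<theta> = -1" using degree_one_grade(1)[OF one] by simp
        then show ?thesis using theta_self degree_one_grade(1)[of "- x"] by (auto simp: heisenberg_ideal_def simp del: pairing_simps)
      qed
      ultimately show ?thesis using x(3) by (cases "w (x, c)") (auto simp: PA_iff)
    qed
  qed
  have "inv_set w = shift heisenberg_ideal"
  proof (intro set_eqI iffI)
    fix q assume "q \<in> inv_set w"
    then show "q \<in> shift heisenberg_ideal" using inv
      by (cases q) (force simp: affine_inversions_def shift_def image_iff)
  next
    fix q assume "q \<in> shift heisenberg_ideal"
    then obtain \<gamma> where g: "\<gamma> \<in> heisenberg_ideal" "q = (- \<gamma>, 1)" by (auto simp: shift_def)
    then have "q \<in> PA" using abelian_ideal_pos[OF heisenberg_ideal_abelian] by (simp add: PA_iff pos_root)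
    then show "q \<in> inv_set w" using inv[of "- \<gamma>" 1] g by (simp add: affine_inversions_def)
  qed
  from ideal_element_eq[OF wW this] have "tau \<Delta> B heisenberg_ideal = (a, 0)"
    by (simp add: tau_def alpha0 theta[symmetric] w theta_self scaleR_2 m basic_imaginary_root_def)
  then show ?thesis using heisenberg_ideal_abelian by (auto simp: tau_fibre_def heisenberg_ideal_def)
qed

text \<open>Write w = (g, s) for the element of J. The root \<nu> sent by g to - \<theta> has degree
  one and pairs to 1 or 2 with s. If it is 2, then s - \<nu> is dominant and pairs to 1 with
  \<theta>, so it is a nonzero minuscule element of the root lattice. If it is 1, then w sends \<nu>
  to the simple affine root \<delta> - \<theta>, which is not a sum of two positive affine roots, so
  \<nu> is simple and thus equal to a. From here s and the relevant signs of g are forced.\<close>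

lemma tau_fibre_unique:
  assumes "J \<in> tau_fibre \<Delta> B a" shows "J = heisenberg_ideal"
proof -
  have J: "abelian_ideal \<Delta> B J" and tau: "tau \<Delta> B J = (a, 0)" using assms by (auto simp: tau_fibre_def)
  define w where "w = ideal_element \<Delta> B J"
  have inv: "inv_set w = shift J" and wA: "w \<in> affine_maps"
    using ideal_element[OF J] affine_weyl_affine_maps by (auto simp: w_def)
  obtain g s where gs: "w = affine_map g s" "g \<in> W" "s \<in> root_lattice"
    using wA unfolding affine_maps_def by auto
  obtain g' where g': "g' \<in> W" "\<And>x. g' (g x) = x" "\<And>x. g (g' x) = x" using weyl_inverseE[OF gs(2)] by blast
  have "w (- \<theta>, 1) + (0, 1) = (a, 0)"
    using tau by (simp add: tau_def w_def alpha0 theta basic_imaginary_root_def)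
  then have g\<theta>: "g \<theta> = - a" and s\<theta>: "\<theta> \<cdot> s = 2"
    by (auto simp: gs(1) weyl_simps[OF gs(2)] minus_equation_iff[of "g \<theta>"])
  have pos: "\<gamma> \<cdot> s \<ge> 0" "\<gamma> \<cdot> s = 0 \<Longrightarrow> g \<gamma> \<in> P" if p: "\<gamma> \<in> P" for \<gamma>
  proof -
    have q: "(\<gamma>, 0) \<in> PA" using p by (simp add: PA_iff pos_root)
    have "(\<gamma>, 0) \<notin> inv_set w" unfolding inv by (auto simp: shift_def)
    then have "- w (\<gamma>, 0) \<notin> PA" using q by (simp add: affine_inversions_def)
    then have "w (\<gamma>, 0) \<in> PA" using neg_PA_iff[OF affine_maps_roots[OF wA PA_affine_roots[OF q]]] by simp
    then show "\<gamma> \<cdot> s \<ge> 0" "\<gamma> \<cdot> s = 0 \<Longrightarrow> g \<gamma> \<in> P" by (auto simp: gs(1) PA_iff)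
  qed
  have mono: "x \<cdot> s \<ge> 0" if "x \<in> nn" for x
    using nn_pairing_nonneg[OF that, of s] pos(1)[OF base_pos] by (simp add: pairing_commute)
  have s_le: "\<gamma> \<cdot> s \<le> 2" if "\<gamma> \<in> \<Delta>" for \<gamma> using mono[OF theta_above[OF that]] s\<theta> by simp
  have s_int: "\<gamma> \<cdot> s \<in> \<int>" if "\<gamma> \<in> \<Delta>" for \<gamma> using root_lattice_pairing_Ints[OF that gs(3)] .
  have not_pos: "\<not> (p \<in> P \<and> - p \<in> P)" for p using neg_pos_iff pos_root by blast
  define \<nu> where "\<nu> = g' (- \<theta>)"
  have g\<nu>: "g \<nu> = - \<theta>" by (simp add: \<nu>_def g')
  have \<nu>\<Delta>: "\<nu> \<in> \<Delta>" using weyl_root[OF g'(1)] theta_root by (simp add: \<nu>_def)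
  have \<nu>1: "\<nu> \<in> degree_one" using \<nu>\<Delta>
    by (rule degree_oneI) (use weyl_isometry[OF gs(2), of \<nu> \<theta>] g\<nu> g\<theta> theta_a in simp)
  have "\<nu> \<cdot> s \<noteq> 0"
    using pos(2)[OF degree_one_pos[OF \<nu>1]] g\<nu> theta_pos not_pos by auto
  then have "\<nu> \<cdot> s = 1 \<or> \<nu> \<cdot> s = 2"
    using pos(1)[OF degree_one_pos[OF \<nu>1]] s_le[OF \<nu>\<Delta>] s_int[OF \<nu>\<Delta>] by (auto elim!: Ints_cases)
  moreover have "\<nu> \<cdot> s \<noteq> 2"
  proof
    assume two: "\<nu> \<cdot> s = 2"
    \<comment> \<open>This t is the translation part after one more affine reflection in \<delta> -
      \<theta>.\<close>
    define t where "t = s - \<nu>"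
    have dom: "\<gamma> \<cdot> t \<ge> 0" if p: "\<gamma> \<in> P" for \<gamma>
    proof -
      note r = pos_root[OF p]
      consider "\<gamma> = \<nu>" | "\<gamma> \<cdot> \<nu> \<le> 0" | "\<gamma> \<cdot> \<nu> = 1" using pairing_cases[OF r \<nu>\<Delta>] by force
      then show ?thesis
      proof cases
        case 1
        then show ?thesis using two by (simp add: t_def pairing_self \<nu>\<Delta>)
      next
        case 2
        then show ?thesis using pos(1)[OF p] by (simp add: t_def)
      next
        case 3
        have "\<gamma> \<cdot> s \<noteq> 0"
        proof
          assume "\<gamma> \<cdot> s = 0"
          then have "g \<gamma> \<in> P" by (rule pos(2)[OF p])
          then have "g \<gamma> \<cdot> \<theta> \<ge> 0" using nn_grade_nonneg pos_nn by blast
          moreover have "g \<gamma> \<cdot> g \<nu> = 1" using 3 weyl_isometry[OF gs(2)] by simp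
          ultimately show False by (simp add: g\<nu>)
        qed
        then have "\<gamma> \<cdot> s \<ge> 1" using pos(1)[OF p] s_int[OF r] by (auto elim!: Ints_cases)
        then show ?thesis using 3 by (simp add: t_def)
      qed
    qed
    have t\<theta>: "\<theta> \<cdot> t = 1" using s\<theta> degree_one_grade[OF \<nu>1] by (simp add: t_def)
    have "\<gamma> \<cdot> t \<le> 1" if "\<gamma> \<in> \<Delta>" for \<gamma>
    proof -
      have "t \<cdot> (\<theta> - \<gamma>) \<ge> 0"
        using nn_pairing_nonneg[OF theta_above[OF that], of t] dom[OF base_pos] by (simp add: pairing_commute)
      then show ?thesis using t\<theta> by (simp add: pairing_commute)
    qed
    moreover have "t \<in> root_lattice"
      using root_lattice_add[OF gs(3) root_lattice_uminus[OF root_lattice_root[OF \<nu>\<Delta>]]] by (simp add: t_def)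
    ultimately have "t = 0" using minuscule_root_lattice by blast
    then show False using t\<theta> by simp
  qed
  ultimately have \<nu>s: "\<nu> \<cdot> s = 1" by blast
  have "\<nu> = a"
  proof (rule ccontr)
    assume "\<nu> \<noteq> a"
    then obtain b where b: "b \<in> B" "b \<noteq> a" "\<nu> \<cdot> b = 1" "\<nu> - b \<in> degree_one" using degree_one_descent[OF \<nu>1] by blast
    have split: "g (\<nu> - b) + g b = - \<theta>" using g\<nu> by (simp add: weyl_simps gs(2))
    have roots: "g (\<nu> - b) \<in> \<Delta>" "g b \<in> \<Delta>"
      using weyl_root[OF gs(2)] degree_one_root[OF b(4)] base_root[OF b(1)] by auto
    \<comment> \<open>One of the two positive summands of \<delta> - \<theta> has level zero, and
      below - \<theta> there is no root.\<close>
    have absurd: False if "p \<in> P" "q \<in> \<Delta>" "p + q = - \<theta>" for p q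
    proof -
      have "\<theta> - (- q) \<in> nn" using that(2) by (intro theta_above) simp
      moreover have "q = - \<theta> - p" using that(3) by (metis add_diff_cancel_left')
      ultimately have "- p \<in> nn" by simp
      then have "p = 0" using nn_antisym pos_nn[OF that(1)] by blast
      then show False using that(1) pos_root root_nonzero by blast
    qed
    have "(\<nu> - b) \<cdot> s + b \<cdot> s = 1" using \<nu>s by simp
    moreover have "(\<nu> - b) \<cdot> s \<in> \<int>" "b \<cdot> s \<in> \<int>" "(\<nu> - b) \<cdot> s \<ge> 0" "b \<cdot> s \<ge> 0"
      using s_int degree_one_root[OF b(4)] base_root[OF b(1)] pos(1)[OF degree_one_pos[OF b(4)]] pos(1)[OF base_pos[OF b(1)]]
      by blast+
    ultimately have "(\<nu> - b) \<cdot> s = 0 \<or> b \<cdot> s = 0" by (auto elim!: Ints_cases simp del: pairing_simps)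
    then show False
    proof
      assume "(\<nu> - b) \<cdot> s = 0"
      from absurd[OF pos(2)[OF degree_one_pos[OF b(4)] this] roots(2) split] show False .
    next
      assume "b \<cdot> s = 0"
      from absurd[OF pos(2)[OF base_pos[OF b(1)] this] roots(1)] split show False by (simp add: add.commute)
    qed
  qed
  then have ga: "g a = - \<theta>" and sa: "a \<cdot> s = 1" using g\<nu> \<nu>s by auto
  \<comment> \<open>On all roots s pairs as \<theta> does: a root of degree one lies between a and
    \<theta> - a, and \<theta> - \<gamma> lies above 2a if \<gamma> has degree zero.\<close>
  have s1: "\<gamma> \<cdot> s = 1" if "\<gamma> \<in> degree_one" for \<gamma>
    using mono[OF degree_one_minus_a[OF that]] mono[OF degree_one_minus_a[OF degree_one_partner[OF that]]] sa s\<theta> by simp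
  have s0: "\<gamma> \<cdot> s = 0" if "\<gamma> \<in> pos_degree_zero" for \<gamma>
  proof -
    have "(\<theta> - \<gamma>) \<cdot> \<theta> = 2" by (simp add: theta_self pos_degree_zero_grade that)
    then have "\<theta> - \<gamma> - 2 *\<^sub>R a \<in> nn" using nn_minus_grade[OF theta_above[OF pos_degree_zero_root[OF that]]] by simp
    then have "(\<theta> - \<gamma> - 2 *\<^sub>R a) \<cdot> s \<ge> 0" by (rule mono)
    then show ?thesis using pos(1)[OF pos_degree_zero_pos[OF that]] s\<theta> sa by simp
  qed
  \<comment> \<open>The reflection in \<theta> corrects g to an element from \<theta> to a.\<close>
  have m: "g \<circ> reflection \<theta> \<in> W" "(g \<circ> reflection \<theta>) \<theta> = a" "(g \<circ> reflection \<theta>) a = a - \<theta>"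
    using gs(2) theta_root
    by (auto simp: weyl_comp weyl_reflection reflection_pairing theta_self a_theta scaleR_2
        weyl_simps g\<theta> ga)
  have sign: "g \<gamma> \<in> P \<longleftrightarrow> \<gamma> \<cdot> a \<le> 0" if g: "\<gamma> \<in> degree_one" for \<gamma>
  proof -
    have "(g \<circ> reflection \<theta>) (\<theta> - \<gamma>) = - g \<gamma>"
      by (simp add: reflection_pairing theta_root theta_self degree_one_grade g weyl_simps gs(2))
    then have "- g \<gamma> \<in> P \<longleftrightarrow> (\<theta> - \<gamma>) \<cdot> a \<le> 0" using degree_one_sign[OF m degree_one_partner[OF g]] by simp
    moreover have "\<gamma> \<cdot> a \<in> \<int>" using pairing_Ints degree_one_root[OF g] a_root by blast
    ultimately show ?thesis using neg_pos_iff[OF weyl_root[OF gs(2) degree_one_root[OF g]]]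
      by (auto simp: theta_a elim!: Ints_cases)
  qed
  have mem: "\<gamma> \<in> J \<longleftrightarrow> \<gamma> \<cdot> s \<ge> 2 \<or> \<gamma> \<cdot> s = 1 \<and> g \<gamma> \<in> P" if p: "\<gamma> \<in> P" for \<gamma>
  proof -
    note r = pos_root[OF p]
    have "(- \<gamma>, 1) \<in> PA" using r by (simp add: PA_iff)
    then have "\<gamma> \<in> J \<longleftrightarrow> - w (- \<gamma>, 1) \<in> PA"
      using shift_iff[of \<gamma> J] by (simp add: inv[symmetric] affine_inversions_def)
    also have "\<dots> \<longleftrightarrow> (g \<gamma>, \<gamma> \<cdot> s - 1) \<in> PA" by (simp add: gs(1) weyl_simps[OF gs(2)])
    finally show ?thesis using weyl_root[OF gs(2) r] s_int[OF r] by (auto simp: PA_iff elim!: Ints_cases)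
  qed
  have "\<gamma> \<in> J \<longleftrightarrow> \<gamma> \<in> heisenberg_ideal" if p: "\<gamma> \<in> P" for \<gamma>
    using p
  proof (cases rule: pos_grade_cases)
    case zero
    then show ?thesis using mem[OF p] s0 by (auto simp: heisenberg_ideal_def pos_degree_zero_def degree_one_def theta_self)
  next
    case one
    then have "\<gamma> \<noteq> \<theta>" using degree_one_grade theta_self by force
    then show ?thesis using mem[OF p] s1[OF one] sign[OF one] one by (simp add: heisenberg_ideal_def)
  next
    case two
    then show ?thesis using mem[OF p] s\<theta> by (simp add: heisenberg_ideal_def)
  qed
  then show ?thesis using abelian_ideal_pos[OF J] abelian_ideal_pos[OF heisenberg_ideal_abelian] by blast
qed

lemma max_ideal_eq: "max_ideal \<Delta> B a = heisenberg_ideal"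
  unfolding max_ideal_def by (rule the_equality) (use heisenberg_ideal_fibre tau_fibre_unique in blast)+


section \<open>Inversions of the elements attached to the ideal\<close>

text \<open>By \<open>degree_one_descent\<close>, simple reflections that fix \<theta> carry
  \<gamma> to a. The shortest such element is already reduced: it preserves degrees, so only roots
  of degree zero can turn negative, and the reflections in these fix \<theta> too. By uniqueness it
  is the shortest of all.\<close>

lemma degree_one_min_element:
  assumes "\<gamma> \<in> degree_one"
  defines "m \<equiv> min_element \<Delta> B \<gamma> a"
  shows "m \<in> W" "m \<gamma> = a" "reduced m \<gamma>" "m \<theta> = \<theta>"
proof -
  note r = degree_one_root[OF assms(1)]
  show m: "m \<in> W" "m \<gamma> = a" "reduced m \<gamma>"
    using min_element[OF r a_root] by (simp_all add: m_def)
  let ?Q = "\<lambda>w. w \<in> W \<and> w \<gamma> = a \<and> w \<theta> = \<theta>"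
  have "\<exists>w. ?Q w" using assms(1)
  proof (induction rule: degree_one_induct)
    case base
    show ?case by (intro exI[of _ id] conjI weyl_id) simp_all
  next
    case (step \<gamma> b)
    then obtain w where w: "w \<in> W" "w (\<gamma> - b) = a" "w \<theta> = \<theta>" by blast
    note b = base_root[OF step.hyps(2)]
    have "(w \<circ> reflection b) \<gamma> = a" "(w \<circ> reflection b) \<theta> = \<theta>"
      using w step.hyps by (simp_all add: reflection_pairing b theta_base)
    moreover have "w \<circ> reflection b \<in> W" using w(1) b by (simp add: weyl_comp weyl_reflection)
    ultimately show ?case by blast
  qed
  then obtain w0 where "?Q w0" by blast
  from ex_has_least_nat[of ?Q, OF this, of "weyl_length B"] obtain w
    where w: "w \<in> W" "w \<gamma> = a" "w \<theta> = \<theta>"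
      and short: "\<And>v. ?Q v \<Longrightarrow> weyl_length B w \<le> weyl_length B v" by blast
  have "reduced w \<gamma>"
    unfolding reduced_def
  proof (intro ballI impI)
    fix p assume p: "p \<in> P" "p \<cdot> \<gamma> = 0"
    note pr = pos_root[OF p(1)]
    have grade: "w p \<cdot> \<theta> = p \<cdot> \<theta>" using weyl_isometry[OF w(1), of p \<theta>] w(3) by simp
    show "w p \<in> P"
    proof (cases "p \<cdot> \<theta> > 0")
      case True
      then show ?thesis using grade grade_pos weyl_root[OF w(1) pr] by simp
    next
      case False
      then have p0: "\<theta> \<cdot> p = 0" using nn_grade_nonneg[OF pos_nn[OF p(1)]] by (simp add: pairing_commute)
      show ?thesis
      proof (rule ccontr)
        assume "w p \<notin> P"
        then have "weyl_length B (w \<circ> reflection p) < weyl_length B w"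
          using weyl_length_exchange w(1) p(1) by blast
        moreover have "?Q (w \<circ> reflection p)"
          using w p0 p(2) by (simp add: weyl_comp weyl_reflection pr reflection_pairing pairing_commute[of \<gamma>])
        ultimately show False using short by fastforce
      qed
    qed
  qed
  then have "m = w" using min_element_eq[OF r a_root w(1,2)] by (simp add: m_def)
  then show "m \<theta> = \<theta>" using w(3) by simp
qed

definition covering_element :: "'a \<Rightarrow> 'a \<Rightarrow> 'a" where
  "covering_element \<gamma> = reflection a \<circ> min_element \<Delta> B \<gamma> a"

lemma covering_element:
  assumes "\<gamma> \<in> \<Delta>" shows "covering_element \<gamma> \<in> W" "covering_element \<gamma> \<gamma> = - a"
  using min_element[OF assms a_root] a_root unfolding covering_element_def
  by (auto simp: reflection_self intro: weyl_comp weyl_reflection)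

lemma covering_element_inject: "\<gamma> \<in> \<Delta> \<Longrightarrow> \<mu> \<in> \<Delta> \<Longrightarrow> covering_element \<gamma> = covering_element \<mu> \<Longrightarrow> \<gamma> = \<mu>"
  using covering_element[of \<gamma>] covering_element[of \<mu>] weyl_inverseE by metis

lemma inversions_iff: "w \<in> W \<Longrightarrow> p \<in> inversions \<Delta> B w \<longleftrightarrow> p \<in> P \<and> w p \<notin> P"
  using weyl_neg_pos_iff[of w p] pos_root[of p] by (auto simp: inversions_def)

lemma simple_reflection_pos_iff:
  assumes "q \<in> \<Delta>" "b \<in> B" "q \<noteq> b" "q \<noteq> - b" shows "reflection b q \<in> P \<longleftrightarrow> q \<in> P"
proof (cases "q \<in> P")
  case True
  then show ?thesis using simple_reflection_pos assms by blast
next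
  case False
  then have "- q \<in> P" using neg_pos_iff[OF assms(1)] by simp
  then have "reflection b (- q) \<in> P" using simple_reflection_pos assms by force
  moreover have "reflection b (- q) = - reflection b q" using linear_neg[OF linear_reflection] .
  ultimately show ?thesis
    using False neg_pos_iff[OF reflection_root[OF base_root[OF assms(2)] assms(1)]] by simp
qed

lemma covering_element_sign:
  assumes "\<gamma> \<in> \<Delta>" "p \<in> \<Delta>" "p \<noteq> \<gamma>" "p \<noteq> - \<gamma>"
  shows "covering_element \<gamma> p \<in> P \<longleftrightarrow> min_element \<Delta> B \<gamma> a p \<in> P"
proof -
  note m = min_element[OF assms(1) a_root]
  obtain v where v: "v \<in> W" "\<And>x. v (min_element \<Delta> B \<gamma> a x) = x" using weyl_inverseE[OF m(1)] by metis
  have "min_element \<Delta> B \<gamma> a p \<noteq> a" using v(2) m(2) assms(3) by metis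
  moreover have "min_element \<Delta> B \<gamma> a p \<noteq> - a"
    using v(2)[of p] v(2)[of "- \<gamma>"] m(2) assms(4) weyl_simps(3)[OF m(1), of \<gamma>] by metis
  ultimately show ?thesis unfolding covering_element_def comp_apply
    by (rule simple_reflection_pos_iff[OF weyl_root[OF m(1) assms(2)] a_base])
qed

text \<open>Roots of degree zero are orthogonal to \<theta> and stay positive because the minimal
  element is reduced; on degree one the signs are those of \<open>degree_one_sign\<close>.\<close>

lemma inversions_covering_theta:
  "p \<in> inversions \<Delta> B (covering_element \<theta>) \<longleftrightarrow> p = \<theta> \<or> p \<in> degree_one \<and> \<not> p \<cdot> a \<le> 0"
proof (cases "p \<in> P")
  case False
  then show ?thesis using degree_one_pos theta_pos by (auto simp: inversions_def)
next
  case p: True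
  have n\<theta>: "p \<noteq> - \<theta>" using p theta_pos neg_pos_iff[OF theta_root] by auto
  note m = min_element_theta
  have i: "p \<in> inversions \<Delta> B (covering_element \<theta>) \<longleftrightarrow> covering_element \<theta> p \<notin> P"
    using inversions_iff[OF covering_element(1)[OF theta_root]] p by simp
  have a: "- a \<notin> P" using neg_pos_iff[OF a_root] a_pos by simp
  show ?thesis
  proof (cases "p = \<theta>")
    case True
    then show ?thesis using i covering_element(2)[OF theta_root] a by simp
  next
    case False
    note sign = covering_element_sign[OF theta_root pos_root[OF p] False n\<theta>]
    from p show ?thesis
    proof (cases rule: pos_grade_cases)
      case zero
      then show ?thesis using i sign False reducedD[OF m(3) p] by (auto simp: pos_degree_zero_grade degree_one_def)
    next
      case one
      then show ?thesis using i sign False degree_one_sign[OF m(1,2,4) one] by simp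
    qed (use False in simp)
  qed
qed

text \<open>The minimal element m fixes \<theta>, hence preserves degrees, so only roots p of degree
  zero are in doubt. If (p, \<gamma>) = 1, then \<gamma> - p is sent to a - m p, a root of degree
  one, which lies above a; so m p is negative. If (p, \<gamma>) = -1, the same argument for \<gamma>
  + p shows that m p is positive.\<close>

lemma inversions_covering_degree_one:
  assumes g: "\<gamma> \<in> degree_one"
  shows "p \<in> inversions \<Delta> B (covering_element \<gamma>) \<longleftrightarrow> p = \<gamma> \<or> p \<in> pos_degree_zero \<and> p \<cdot> \<gamma> = 1"
proof (cases "p \<in> P")
  case False
  then show ?thesis using degree_one_pos[OF g] by (auto simp: inversions_def pos_degree_zero_def)
next
  case p: True
  note r = degree_one_root[OF g] and pr = pos_root[OF p]
  define m where "m = min_element \<Delta> B \<gamma> a"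
  note m = degree_one_min_element[OF g, folded m_def]
  have n\<gamma>: "p \<noteq> - \<gamma>" using p degree_one_pos[OF g] neg_pos_iff[OF r] by auto
  have i: "p \<in> inversions \<Delta> B (covering_element \<gamma>) \<longleftrightarrow> covering_element \<gamma> p \<notin> P"
    using inversions_iff[OF covering_element(1)[OF r]] p by simp
  have a: "- a \<notin> P" using neg_pos_iff[OF a_root] a_pos by simp
  have grade: "m x \<cdot> \<theta> = x \<cdot> \<theta>" for x using weyl_isometry[OF m(1), of x \<theta>] m(4) by simp
  have mr: "m p \<in> \<Delta>" using weyl_root[OF m(1) pr] .
  have m_degree_one: "m x \<in> degree_one" if "x \<in> degree_one" for x
    using weyl_root[OF m(1) degree_one_root[OF that]] grade[of x] degree_one_grade(1)[OF that] by (intro degree_oneI) simp_all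
  show ?thesis
  proof (cases "p = \<gamma>")
    case True
    then show ?thesis using i covering_element(2)[OF r] a by simp
  next
    case False
    have sign: "covering_element \<gamma> p \<in> P \<longleftrightarrow> m p \<in> P" using covering_element_sign[OF r pr False n\<gamma>] by (simp add: m_def)
    from p show ?thesis
    proof (cases rule: pos_grade_cases)
      case zero
      consider "p \<cdot> \<gamma> = 0" | "p \<cdot> \<gamma> = 1" | "p \<cdot> \<gamma> = -1" using pairing_cases[OF pr r] False n\<gamma> by auto
      then have "m p \<in> P \<longleftrightarrow> p \<cdot> \<gamma> \<noteq> 1"
      proof cases
        case 1
        then show ?thesis using reducedD[OF m(3) p] by simp
      next
        case 2
        have "\<gamma> - p \<in> degree_one" using root_diff[OF r pr] 2
          by (intro degree_oneI) (simp_all add: pairing_commute[of \<gamma> p] degree_one_grade g pos_degree_zero_grade zero)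
        from degree_one_minus_a[OF m_degree_one[OF this]] have "- m p \<in> nn" by (simp add: weyl_simps m(1,2))
        then have "- m p \<in> P" using posI mr by simp
        then show ?thesis using 2 neg_pos_iff[OF mr] by simp
      next
        case 3
        have "\<gamma> + p \<in> degree_one" using root_add[OF r pr] 3
          by (intro degree_oneI) (simp_all add: pairing_commute[of \<gamma> p] degree_one_grade g pos_degree_zero_grade zero)
        from degree_one_minus_a[OF m_degree_one[OF this]] have "m p \<in> nn" by (simp add: weyl_simps m(1,2))
        then show ?thesis using 3 posI[OF mr] by simp
      qed
      then show ?thesis using i sign False zero by simp
    next
      case one
      then have "m p \<in> P" using m_degree_one degree_one_pos by blast
      then show ?thesis using i sign False one by (auto simp: pos_degree_zero_def degree_one_grade)
    next
      case two
      then have "m p \<in> P" using m(4) theta_pos by simp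
      then show ?thesis using i sign False two by (auto simp: pos_degree_zero_def theta_self)
    qed
  qed
qed

section \<open>Roots of degree zero are never covered exactly once\<close>

text \<open>On the way down from \<gamma> to a by simple roots of degree zero the pairing with a
  rises from 0 to 2. The first simple root not orthogonal to a serves as \<mu>; the reflections
  passed before fix a and carry it back.\<close>

lemma degree_one_split:
  assumes "\<gamma> \<in> degree_one" "\<gamma> \<cdot> a = 0"
  shows "\<exists>\<mu>\<in>\<Delta>. \<mu> \<cdot> \<theta> = 0 \<and> \<mu> \<cdot> a = -1 \<and> \<gamma> \<cdot> \<mu> = 1"
  using assms
proof (induction rule: degree_one_induct)
  case base
  then show ?case by (simp add: a_self)
next
  case (step \<gamma> b)
  note b = base_root[OF step.hyps(2)]
  have b\<theta>: "b \<cdot> \<theta> = 0" using theta_base[OF step.hyps(2,3)] by (simp add: pairing_commute[of b])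
  then have "b \<in> pos_degree_zero" using base_pos step.hyps by (simp add: pos_degree_zero_def)
  from pos_degree_zero_pairing_a[OF this] show ?case
  proof
    assume ba: "b \<cdot> a = 0"
    then have "(\<gamma> - b) \<cdot> a = 0" using step.prems by simp
    from step.IH[OF this] obtain \<mu>
      where \<mu>: "\<mu> \<in> \<Delta>" "\<mu> \<cdot> \<theta> = 0" "\<mu> \<cdot> a = -1" "(\<gamma> - b) \<cdot> \<mu> = 1" by blast
    have "reflection b \<mu> \<in> \<Delta>" using reflection_root b \<mu>(1) by blast
    moreover have "reflection b \<mu> \<cdot> \<theta> = 0" "reflection b \<mu> \<cdot> a = -1" "\<gamma> \<cdot> reflection b \<mu> = 1"
      using \<mu> ba b\<theta> step.hyps by (simp_all add: reflection_pairing b pairing_commute[of b \<mu>])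
    ultimately show ?thesis by blast
  next
    assume "b \<cdot> a = -1"
    then show ?thesis using b b\<theta> step.hyps by blast
  qed
qed

lemma degree_one_splitE:
  assumes "\<gamma> \<in> degree_one" "\<gamma> \<cdot> a = 0"
  obtains \<mu> \<mu>' where "\<mu> \<in> \<Delta>" "\<mu> \<cdot> \<theta> = 0" "\<mu> \<cdot> a = -1" "\<mu>' \<in> \<Delta>" "\<mu>' \<cdot> \<theta> = 0" "\<mu>' \<cdot> a = -1"
    "\<gamma> \<cdot> \<mu> = 1" "\<gamma> \<cdot> \<mu>' = 1" "\<gamma> = a + \<mu> + \<mu>'"
proof -
  obtain \<mu> where \<mu>: "\<mu> \<in> \<Delta>" "\<mu> \<cdot> \<theta> = 0" "\<mu> \<cdot> a = -1" "\<gamma> \<cdot> \<mu> = 1" using degree_one_split[OF assms] by blast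
  define \<mu>' where "\<mu>' = \<gamma> - \<mu> - a"
  have "\<gamma> - \<mu> \<in> \<Delta>" using root_diff degree_one_root[OF assms(1)] \<mu> by blast
  then have "\<mu>' \<in> \<Delta>" unfolding \<mu>'_def by (rule root_diff[OF _ a_root]) (simp add: assms(2) \<mu>)
  moreover have "\<mu>' \<cdot> \<theta> = 0" "\<mu>' \<cdot> a = -1" "\<gamma> \<cdot> \<mu>' = 1"
    by (simp_all add: \<mu>'_def assms \<mu> degree_one_grade a_theta a_self pairing_self degree_one_root)
  moreover have "\<gamma> = a + \<mu> + \<mu>'" by (simp add: \<mu>'_def)
  ultimately show ?thesis using that[OF \<mu>(1-3), of \<mu>'] \<mu>(4) by blast
qed

text \<open>Let \<beta> = \<theta> - a. If (\<nu>, a) = -1, then \<beta> itself is one choice.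
  Splitting \<beta> - \<nu> as a + \<mu> + \<mu>' by \<open>degree_one_splitE\<close> gives roots
  orthogonal to \<nu>, and \<nu> + a + \<mu> is another choice. If (\<nu>, a) = 0, then \<gamma> is
  orthogonal to a and splits as a + \<mu>1 + \<mu>2, where one summand \<mu> pairs to 1 with \<nu>;
  replacing \<gamma> by \<beta> - \<mu> + \<nu> gives a second root.\<close>

lemma second_cover:
  assumes \<nu>: "\<nu> \<in> pos_degree_zero" and \<gamma>: "\<gamma> \<in> degree_one" "\<gamma> \<cdot> a \<le> 0" "\<nu> \<cdot> \<gamma> = 1"
  shows "\<exists>\<gamma>'\<in>degree_one. \<gamma>' \<cdot> a \<le> 0 \<and> \<nu> \<cdot> \<gamma>' = 1 \<and> \<gamma>' \<noteq> \<gamma>"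
proof -
  note \<nu>r = pos_degree_zero_root[OF \<nu>] and \<nu>\<theta> = pos_degree_zero_grade[OF \<nu>]
  let ?\<beta> = "\<theta> - a"
  have \<beta>: "?\<beta> \<in> degree_one" using degree_one_partner[OF a_degree_one] .
  have \<beta>a: "?\<beta> \<cdot> a = -1" by (simp add: theta_a a_self)
  from pos_degree_zero_pairing_a[OF \<nu>] show ?thesis
  proof
    assume \<nu>a: "\<nu> \<cdot> a = -1"
    have \<beta>\<nu>: "\<nu> \<cdot> ?\<beta> = 1" by (simp add: \<nu>\<theta> \<nu>a)
    have "?\<beta> - \<nu> \<in> degree_one" using root_diff[OF degree_one_root[OF \<beta>] \<nu>r] \<beta>\<nu> degree_one_grade(1)[OF \<beta>] \<nu>\<theta>
      by (intro degree_oneI) (simp_all add: pairing_commute[of \<theta> \<nu>] pairing_commute[of a \<nu>])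
    moreover have "(?\<beta> - \<nu>) \<cdot> a = 0" using \<beta>a \<nu>a by simp
    ultimately obtain \<mu> \<mu>' where \<mu>: "\<mu> \<in> \<Delta>" "\<mu> \<cdot> \<theta> = 0" "\<mu> \<cdot> a = -1"
      and \<mu>': "\<mu>' \<in> \<Delta>" "\<mu>' \<cdot> \<theta> = 0" "\<mu>' \<cdot> a = -1" and sum: "?\<beta> - \<nu> = a + \<mu> + \<mu>'"
      by (rule degree_one_splitE)
    \<comment> \<open>Otherwise x + \<nu> would be a root of degree zero pairing to -2 with a, hence
      equal to - a.\<close>
    have nonneg: "x \<cdot> \<nu> \<ge> 0" if x: "x \<in> \<Delta>" "x \<cdot> \<theta> = 0" "x \<cdot> a = -1" for x
    proof -
      have "x \<noteq> - \<nu>" using x(3) \<nu>a by auto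
      moreover have "x \<cdot> \<nu> \<noteq> -1"
      proof
        assume "x \<cdot> \<nu> = -1"
        then have "x + \<nu> \<in> \<Delta>" using root_add x(1) \<nu>r by blast
        moreover have "(x + \<nu>) \<cdot> a = -2" using x(3) \<nu>a by simp
        ultimately have "x + \<nu> = - a" using pairing_minus_2D a_root by blast
        moreover have "(x + \<nu>) \<cdot> \<theta> = 0" using x(2) \<nu>\<theta> by simp
        ultimately show False using a_theta by (simp del: pairing_simps(1))
      qed
      ultimately show ?thesis using pairing_cases[OF x(1) \<nu>r] by auto
    qed
    have "(?\<beta> - \<nu>) \<cdot> \<nu> = -1" using \<beta>\<nu>
      by (simp add: pairing_commute[of \<theta> \<nu>] pairing_commute[of a \<nu>] pairing_self \<nu>r)
    then have "\<mu> \<cdot> \<nu> + \<mu>' \<cdot> \<nu> = 0" unfolding sum using \<nu>a by (simp add: pairing_commute[of a \<nu>])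
    then have \<mu>\<nu>: "\<mu> \<cdot> \<nu> = 0" using nonneg[OF \<mu>] nonneg[OF \<mu>'] by linarith
    let ?\<gamma>0 = "\<nu> + a + \<mu>"
    have "\<nu> + a \<in> \<Delta>" using root_add[OF \<nu>r a_root \<nu>a] .
    then have "?\<gamma>0 \<in> \<Delta>" by (rule root_add[OF _ \<mu>(1)]) (simp add: pairing_commute[of \<nu> \<mu>] pairing_commute[of a \<mu>] \<mu> \<mu>\<nu>)
    then have "?\<gamma>0 \<in> degree_one" by (rule degree_oneI) (simp add: \<mu> \<nu>\<theta> a_theta)
    moreover have a0: "?\<gamma>0 \<cdot> a = 0" by (simp add: \<mu> \<nu>a a_self)
    moreover have "\<nu> \<cdot> ?\<gamma>0 = 1" by (simp add: pairing_self \<nu>r \<nu>a pairing_commute[of \<nu> \<mu>] \<mu>\<nu>)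
    moreover have "?\<gamma>0 \<noteq> ?\<beta>" using a0 \<beta>a by (metis zero_neq_neg_one)
    ultimately show ?thesis using \<beta> \<beta>a \<beta>\<nu>
      by (cases "\<gamma> = ?\<beta>") (force intro: bexI[of _ ?\<gamma>0], force intro: bexI[of _ ?\<beta>])
  next
    assume \<nu>a: "\<nu> \<cdot> a = 0"
    have "\<gamma> \<cdot> a \<noteq> -1"
    proof
      assume "\<gamma> \<cdot> a = -1"
      then have "\<gamma> + a \<in> \<Delta>" using root_add degree_one_root[OF \<gamma>(1)] a_root by blast
      then have "\<gamma> + a = \<theta>" using grade_two[of "\<gamma> + a"] by (simp add: degree_one_grade \<gamma>(1) a_theta)
      then have "\<nu> \<cdot> (\<gamma> + a) = 0" using \<nu>\<theta> by simp
      then show False using \<gamma>(3) \<nu>a by simp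
    qed
    moreover have "\<gamma> \<noteq> - a" using degree_one_pos[OF \<gamma>(1)] neg_pos_iff[OF a_root] a_pos by auto
    ultimately have "\<gamma> \<cdot> a = 0" using pairing_cases[OF degree_one_root[OF \<gamma>(1)] a_root] \<gamma>(2) by auto
    with \<gamma>(1) obtain \<mu>1 \<mu>2 where \<mu>1: "\<mu>1 \<in> \<Delta>" "\<mu>1 \<cdot> \<theta> = 0" "\<mu>1 \<cdot> a = -1" "\<gamma> \<cdot> \<mu>1 = 1"
      and \<mu>2: "\<mu>2 \<in> \<Delta>" "\<mu>2 \<cdot> \<theta> = 0" "\<mu>2 \<cdot> a = -1" "\<gamma> \<cdot> \<mu>2 = 1" and sum: "\<gamma> = a + \<mu>1 + \<mu>2"
      by (rule degree_one_splitE)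
    have le: "x \<cdot> \<nu> \<in> {-1, 0, 1}" if "x \<in> \<Delta>" "x \<cdot> a = -1" for x
      using pairing_cases[OF that(1) \<nu>r] that(2) \<nu>a by auto
    have "\<nu> \<cdot> (a + \<mu>1 + \<mu>2) = 1" using \<gamma>(3) sum by simp
    then have "\<mu>1 \<cdot> \<nu> + \<mu>2 \<cdot> \<nu> = 1" using \<nu>a
      by (simp add: pairing_commute[of \<nu> \<mu>1] pairing_commute[of \<nu> \<mu>2])
    then have "\<mu>1 \<cdot> \<nu> = 1 \<or> \<mu>2 \<cdot> \<nu> = 1" using le[OF \<mu>1(1,3)] le[OF \<mu>2(1,3)] by auto
    then obtain \<mu> where \<mu>: "\<mu> \<in> \<Delta>" "\<mu> \<cdot> \<theta> = 0" "\<mu> \<cdot> a = -1" "\<gamma> \<cdot> \<mu> = 1" "\<mu> \<cdot> \<nu> = 1"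
      using \<mu>1 \<mu>2 by blast
    let ?\<gamma>' = "?\<beta> - \<mu> + \<nu>"
    have "?\<beta> - \<mu> \<in> \<Delta>" by (rule root_diff[OF degree_one_root[OF \<beta>] \<mu>(1)])
      (simp add: \<mu> pairing_commute[of \<theta> \<mu>] pairing_commute[of a \<mu>])
    then have "?\<gamma>' \<in> \<Delta>" by (rule root_add[OF _ \<nu>r]) (simp add: \<mu> \<nu>\<theta> \<nu>a pairing_commute[of a \<nu>])
    then have "?\<gamma>' \<in> degree_one" by (rule degree_oneI) (simp add: \<mu> \<nu>\<theta> theta_self a_theta)
    moreover have "?\<gamma>' \<cdot> a = 0" by (simp add: \<mu> \<nu>a theta_a a_self)
    moreover have "\<nu> \<cdot> ?\<gamma>' = 1" by (simp add: pairing_self \<nu>r \<nu>\<theta> \<nu>a pairing_commute[of \<nu> \<mu>] \<mu>)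
    moreover have "?\<gamma>' \<noteq> \<gamma>"
    proof
      assume "?\<gamma>' = \<gamma>"
      moreover have "\<mu> \<cdot> ?\<gamma>' = 0" by (simp add: \<mu> pairing_self)
      ultimately show False using \<mu>(4) pairing_commute[of \<mu> \<gamma>] by (metis zero_neq_one)
    qed
    ultimately show ?thesis by (intro bexI[of _ ?\<gamma>']) auto
  qed
qed

section \<open>The essential roots\<close>

lemma ideal_inversion_set_eq: "ideal_inversion_set \<Delta> B a = covering_element ` heisenberg_ideal"
  by (auto simp: ideal_inversion_set_def max_ideal_eq covering_element_def)

text \<open>Distinct roots of the ideal give distinct elements, because each root is recovered as
  the preimage of - a. So covering by elements can be counted by roots.\<close>

lemma Ess_iff: "p \<in> Ess \<Delta> B (covering_element ` heisenberg_ideal) \<longleftrightarrow> p \<in> P \<and> (\<exists>!\<gamma>. \<gamma> \<in> heisenberg_ideal \<and> p \<in> inversions \<Delta> B (covering_element \<gamma>))"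
proof -
  have r: "\<gamma> \<in> \<Delta>" if "\<gamma> \<in> heisenberg_ideal" for \<gamma> using abelian_ideal_pos[OF heisenberg_ideal_abelian that] pos_root by blast
  have "(\<exists>!w. w \<in> covering_element ` heisenberg_ideal \<and> p \<in> inversions \<Delta> B w)
      \<longleftrightarrow> (\<exists>!\<gamma>. \<gamma> \<in> heisenberg_ideal \<and> p \<in> inversions \<Delta> B (covering_element \<gamma>))"
    using covering_element_inject r by (auto simp: Ex1_def)
  then show ?thesis by (simp add: Ess_def)
qed

lemma Ess_eq: "Ess \<Delta> B (ideal_inversion_set \<Delta> B a) = {\<gamma> \<in> P. \<gamma> \<cdot> \<theta> > 0}"
proof (intro set_eqI)
  fix p
  have \<theta>1: "\<theta> \<notin> degree_one" "\<theta> \<notin> pos_degree_zero" by (auto simp: degree_one_def pos_degree_zero_def theta_self)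
  have disj: "p \<in> degree_one \<Longrightarrow> p \<notin> pos_degree_zero" by (auto simp: degree_one_def pos_degree_zero_def)
  have "(\<exists>!\<gamma>. \<gamma> \<in> heisenberg_ideal \<and> p \<in> inversions \<Delta> B (covering_element \<gamma>)) \<longleftrightarrow> p \<cdot> \<theta> > 0" if p: "p \<in> P"
    using p
  proof (cases rule: pos_grade_cases)
    case zero
    have "\<gamma> \<in> heisenberg_ideal \<and> p \<in> inversions \<Delta> B (covering_element \<gamma>) \<longleftrightarrow> \<gamma> \<in> degree_one \<and> \<gamma> \<cdot> a \<le> 0 \<and> p \<cdot> \<gamma> = 1" for \<gamma>
      using inversions_covering_theta[of p] inversions_covering_degree_one[of \<gamma> p] zero disj \<theta>1
      by (auto simp: heisenberg_ideal_def)
    then have "\<not> (\<exists>!\<gamma>. \<gamma> \<in> heisenberg_ideal \<and> p \<in> inversions \<Delta> B (covering_element \<gamma>))"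
      using second_cover[OF zero] by blast
    then show ?thesis using pos_degree_zero_grade(1)[OF zero] by simp
  next
    case one
    let ?\<gamma> = "if p \<cdot> a \<le> 0 then p else \<theta>"
    have "\<gamma> \<in> heisenberg_ideal \<and> p \<in> inversions \<Delta> B (covering_element \<gamma>) \<longleftrightarrow> \<gamma> = ?\<gamma>" for \<gamma>
      using inversions_covering_theta[of p] inversions_covering_degree_one[of \<gamma> p] one disj \<theta>1
      by (auto simp: heisenberg_ideal_def)
    then show ?thesis using degree_one_grade(1)[OF one] by simp
  next
    case two
    have "\<gamma> \<in> heisenberg_ideal \<and> p \<in> inversions \<Delta> B (covering_element \<gamma>) \<longleftrightarrow> \<gamma> = \<theta>" for \<gamma>
      using inversions_covering_theta[of p] inversions_covering_degree_one[of \<gamma> p] two \<theta>1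
      by (auto simp: heisenberg_ideal_def)
    then show ?thesis using two theta_self by simp
  qed
  then show "p \<in> Ess \<Delta> B (ideal_inversion_set \<Delta> B a) \<longleftrightarrow> p \<in> {\<gamma> \<in> P. \<gamma> \<cdot> \<theta> > 0}"
    by (auto simp: ideal_inversion_set_eq Ess_iff)
qed

end

theorem theorem0p3:
  fixes \<Delta> B :: "'a::euclidean_space set" and \<theta> \<alpha> :: 'a
  assumes "irreducible_root_system \<Delta>"
    and "root_base \<Delta> B"
    and "simply_laced \<Delta>"
    and "\<theta> = highest_root \<Delta> B"
    and "fundamental_weight B \<theta>"
    and "\<alpha> \<in> B"
    and "\<theta> \<bullet> \<alpha> \<noteq> 0"
  shows "Ess \<Delta> B (ideal_inversion_set \<Delta> B \<alpha>) = {\<gamma> \<in> pos_roots \<Delta> B. \<gamma> \<bullet> \<theta> > 0}"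
proof -
  define N where "N = \<alpha> \<bullet> \<alpha>"
  have B: "B \<subseteq> \<Delta>" using assms(2) by (simp add: root_base_def)
  have sq: "\<gamma> \<bullet> \<gamma> = N" if "\<gamma> \<in> \<Delta>" for \<gamma>
  proof -
    have "norm \<gamma> = norm \<alpha>" using assms(3,6) B that unfolding simply_laced_def by blast
    then show ?thesis unfolding N_def dot_square_norm by (rule arg_cong)
  qed
  have N: "N > 0" using assms(7) by (auto simp: N_def)
  interpret laced_root_system \<Delta> B N
    by unfold_locales (use assms(1,2) sq N in auto)
  obtain \<alpha>' where a': "\<alpha>' \<in> B" "\<And>b. b \<in> B \<Longrightarrow> 2 * (\<theta> \<bullet> b) / (b \<bullet> b) = (if b = \<alpha>' then 1 else 0)"
    using assms(5) unfolding fundamental_weight_def by blast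
  have "b \<bullet> b = N" if "b \<in> B" for b using that B sq by blast
  then have pair: "pairing \<theta> b = (if b = \<alpha>' then 1 else 0)" if "b \<in> B" for b
    using a'(2)[OF that] that by (simp add: pairing_def)
  have "pairing \<theta> \<alpha> \<noteq> 0" using assms(7) N by (simp add: pairing_def)
  then have "\<alpha> = \<alpha>'" using pair[OF assms(6)] by (auto split: if_splits)
  then interpret heisenberg_grading \<Delta> B N \<theta> \<alpha>
    by unfold_locales (use assms(4,6) pair in auto)
  have "pairing \<gamma> \<theta> > 0 \<longleftrightarrow> \<gamma> \<bullet> \<theta> > 0" for \<gamma> using N by (simp add: pairing_def zero_less_divide_iff)
  then show ?thesis using Ess_eq by simp
qed

end
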